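(* Let $\mathbb{B}$ be a Banach space and let $f\in\mathfrak{D}(\mathbb{B})$ satisfy uniformly continuous generalized hyperbolicity, with projections $\{P_x,Q_x\}_{x\in\mathbb{B}}$ and subspaces $E^s_x=P_x(\mathbb{B})$, $E^u_x=Q_x(\mathbb{B})$. Then there exist $M>0$ and $d_0>0$ such that for any $d\in(0,d_0)$ and any diffeomorphism $g\in\mathfrak{D}(\mathbb{B})$ with $\|f-g\|_{C^1}<d$ the following holds. (S1) There exist uniformly continuous maps $h_1,h_2:\mathbb{B}\to\mathbb{B}$ satisfying $$g\circ(Id+h_1)=(Id+h_1)\circ f,\qquad f\circ(Id+h_2)=(Id+h_2)\circ g,$$ $$|h_1(x)|,\ |h_2(x)|<Md,\qquad x\in\mathbb{B};$$ hence $f$ is uniformly semi-structurally stable. (S2) If additionally the spaces $E^s_x\oplus(Df(x))^{-1}E^u_{f(x)}$ do not depend on $x$, then $h_1,h_2$ can be chosen such that $$(Id+h_1)\circ(Id+h_2)=Id,\qquad (Id+h_2)\circ(Id+h_1)=Id.$$ In that case the maps $Id+h_1$ and $Id+h_2$ are homeomorphisms, and hence $f$ is uniformly structurally stable.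
   Context: $\mathbb{B}$ is an arbitrary Banach space with norm $|\cdot|$. $\mathfrak{D}(\mathbb{B})$ is the set of $C^1$-diffeomorphisms $f:\mathbb{B}\to\mathbb{B}$ (Fréchet derivative $Df$) for which there exist $R>0$ and a nondecreasing function $r:\mathbb{R}^+\to\mathbb{R}^+$ with $\lim_{z\to0}r(z)=0$ such that for all $x,v\in\mathbb{B}$, $v\neq0$: $|f(x+v)-f(x)-Df(x)v|\le|v|\,r(|v|)$; $\|Df(x)\|\le R$ and $\|D(f^{-1})(x)\|\le R$; $\|Df(x+v)-Df(x)\|\le r(|v|)$. The extended distance is $\|f-g\|_{C^1}=\sup_x|f(x)-g(x)|+\sup_x\|Df(x)-Dg(x)\|$ (possibly infinite). $f$ satisfies generalized hyperbolicity with constants $C>0$, $\lambda\in(0,1)$ if for every $x\in\mathbb{B}$ there are bounded linear projections $P_x,Q_x:\mathbb{B}\to\mathbb{B}$ such that, with $E^s_x=P_x(\mathbb{B})$, $E^u_x=Q_x(\mathbb{B})$: (GH1) $P_x+Q_x=Id$, $\|P_x\|,\|Q_x\|\le C$; (GH2) $Df(x)E^s_x\subseteq E^s_{f(x)}$ and $D(f^{-1})(x)E^u_x\subseteq E^u_{f^{-1}(x)}$; (GH3) for every integer $n>0$, $|D(f^n)(x)v|\le C\lambda^n|v|$ for $v\in E^s_x$ and $|D(f^{-n})(x)v|\le C\lambda^n|v|$ for $v\in E^u_x$. $f$ satisfies uniformly continuous generalized hyperbolicity if it satisfies generalized hyperbolicity (for some $C,\lambda$) with a family of projections such that, in addition,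 for every $\varepsilon>0$ there is $\delta>0$ with $\|P_x-P_y\|,\|Q_x-Q_y\|<\varepsilon$ whenever $|x-y|<\delta$. $f\in\mathfrak{D}(\mathbb{B})$ is uniformly semi-structurally stable if for every $\varepsilon>0$ there exists $d_0=d_0(\varepsilon)>0$ such that for any $g\in\mathfrak{D}(\mathbb{B})$ with $\|f-g\|_{C^1}<d_0$ there exist uniformly continuous maps $h_1,h_2:\mathbb{B}\to\mathbb{B}$ with $\sup_x|h_1(x)|,\sup_x|h_2(x)|<\varepsilon$, $g\circ(Id+h_1)=(Id+h_1)\circ f$ and $f\circ(Id+h_2)=(Id+h_2)\circ g$. $f\in\mathfrak{D}(\mathbb{B})$ is uniformly structurally stable if for every $\varepsilon>0$ there exists $d_0=d_0(\varepsilon)>0$ such that for any $g\in\mathfrak{D}(\mathbb{B})$ with $\|f-g\|_{C^1}<d_0$ there exists a continuous map $h_1:\mathbb{B}\to\mathbb{B}$ with $\sup_x|h_1(x)|<\varepsilon$ such that $Id+h_1$ is a homeomorphism, $g\circ(Id+h_1)=(Id+h_1)\circ f$, and both $Id+h_1$ and $(Id+h_1)^{-1}$ are uniformly continuous. *)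

theory Defs
  imports "HOL-Analysis.Analysis" "HOL-Library.Set_Algebras"
begin

(* The Frechet derivative as an element of the Banach space of bounded operators, so that norm is
   the operator norm; meaningful only where f is differentiable (see fderiv_works). *)
definition fderiv :: "('a::real_normed_vector \<Rightarrow> 'b::real_normed_vector) \<Rightarrow> 'a \<Rightarrow> 'a \<Rightarrow>\<^sub>L 'b" where
  "fderiv f x = Blinfun (frechet_derivative f (at x))"

lemma fderiv_works:
  assumes "f differentiable (at x)"
  shows "(f has_derivative blinfun_apply (fderiv f x)) (at x)"
  using assms unfolding fderiv_def frechet_derivative_works
  by (simp add: bounded_linear_Blinfun_apply has_derivative_bounded_linear)

definition C1_map :: "('a::real_normed_vector \<Rightarrow> 'b::real_normed_vector) \<Rightarrow> bool" where
  "C1_map f \<longleftrightarrow> (\<forall>x. f differentiable (at x)) \<and> continuous_on UNIV (fderiv f)"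

definition C1_diffeo :: "('a::real_normed_vector \<Rightarrow> 'a) \<Rightarrow> bool" where
  "C1_diffeo f \<longleftrightarrow> bij f \<and> C1_map f \<and> C1_map (inv f)"

(* Only the values of r on the half-line [0, infinity) matter. *)
definition diffeo_class :: "('a::banach \<Rightarrow> 'a) set" where
  "diffeo_class = {f. C1_diffeo f \<and>
     (\<exists>R>0. \<exists>r :: real \<Rightarrow> real.
        (\<forall>z\<ge>0. 0 \<le> r z) \<and> mono_on {0..} r \<and> (r \<longlongrightarrow> 0) (at_right 0) \<and>
        (\<forall>x v. v \<noteq> 0 \<longrightarrow>
           norm (f (x + v) - f x - fderiv f x v) \<le> norm v * r (norm v) \<and>
           norm (fderiv f x) \<le> R \<and> norm (fderiv (inv f) x) \<le> R \<and>
           norm (fderiv f (x + v) - fderiv f x) \<le> r (norm v)))}"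

(* Extended-real valued: a supremum of type real would have an unspecified value on unbounded sets. *)
definition sup_norm :: "('a \<Rightarrow> 'b::real_normed_vector) \<Rightarrow> ereal" where
  "sup_norm h = (SUP x. ereal (norm (h x)))"

definition C1_dist :: "('a::banach \<Rightarrow> 'a) \<Rightarrow> ('a \<Rightarrow> 'a) \<Rightarrow> ereal" where
  "C1_dist f g = sup_norm (\<lambda>x. f x - g x) + sup_norm (\<lambda>x. fderiv f x - fderiv g x)"

definition gen_hyperbolic ::
  "('a::banach \<Rightarrow> 'a) \<Rightarrow> real \<Rightarrow> real \<Rightarrow> ('a \<Rightarrow> 'a \<Rightarrow>\<^sub>L 'a) \<Rightarrow> ('a \<Rightarrow> 'a \<Rightarrow>\<^sub>L 'a) \<Rightarrow> bool" where
  "gen_hyperbolic f C lam P Q \<longleftrightarrow>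
     C > 0 \<and> 0 < lam \<and> lam < 1 \<and>
     (\<forall>x.
        P x o\<^sub>L P x = P x \<and> Q x o\<^sub>L Q x = Q x \<and>
        P x + Q x = id_blinfun \<and> norm (P x) \<le> C \<and> norm (Q x) \<le> C \<and>
        fderiv f x ` range (P x) \<subseteq> range (P (f x)) \<and>
        fderiv (inv f) x ` range (Q x) \<subseteq> range (Q (inv f x)) \<and>
        (\<forall>n>0.
           (\<forall>v \<in> range (P x). norm (fderiv (f ^^ n) x v) \<le> C * lam ^ n * norm v) \<and>
           (\<forall>v \<in> range (Q x). norm (fderiv (inv f ^^ n) x v) \<le> C * lam ^ n * norm v)))"

definition uc_gen_hyperbolic ::
  "('a::banach \<Rightarrow> 'a) \<Rightarrow> ('a \<Rightarrow> 'a \<Rightarrow>\<^sub>L 'a) \<Rightarrow> ('a \<Rightarrow> 'a \<Rightarrow>\<^sub>L 'a) \<Rightarrow> bool" where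
  "uc_gen_hyperbolic f P Q \<longleftrightarrow>
     (\<exists>C lam. gen_hyperbolic f C lam P Q) \<and>
     uniformly_continuous_on UNIV P \<and> uniformly_continuous_on UNIV Q"

abbreviation Id_plus :: "('a::banach \<Rightarrow> 'a) \<Rightarrow> 'a \<Rightarrow> 'a" where
  "Id_plus h \<equiv> (\<lambda>x. x + h x)"

definition unif_semi_struct_stable :: "('a::banach \<Rightarrow> 'a) \<Rightarrow> bool" where
  "unif_semi_struct_stable f \<longleftrightarrow>
     (\<forall>\<epsilon>>0. \<exists>d0>0. \<forall>g \<in> diffeo_class. C1_dist f g < ereal d0 \<longrightarrow>
        (\<exists>h1 h2. uniformly_continuous_on UNIV h1 \<and> uniformly_continuous_on UNIV h2 \<and>
           sup_norm h1 < ereal \<epsilon> \<and> sup_norm h2 < ereal \<epsilon> \<and>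
           g \<circ> Id_plus h1 = Id_plus h1 \<circ> f \<and>
           f \<circ> Id_plus h2 = Id_plus h2 \<circ> g))"

definition unif_struct_stable :: "('a::banach \<Rightarrow> 'a) \<Rightarrow> bool" where
  "unif_struct_stable f \<longleftrightarrow>
     (\<forall>\<epsilon>>0. \<exists>d0>0. \<forall>g \<in> diffeo_class. C1_dist f g < ereal d0 \<longrightarrow>
        (\<exists>h1. continuous_on UNIV h1 \<and> sup_norm h1 < ereal \<epsilon> \<and>
           homeomorphism UNIV UNIV (Id_plus h1) (inv (Id_plus h1)) \<and>
           g \<circ> Id_plus h1 = Id_plus h1 \<circ> f \<and>
           uniformly_continuous_on UNIV (Id_plus h1) \<and>
           uniformly_continuous_on UNIV (inv (Id_plus h1))))"

(* The preimage under Df(x) is the image under its inverse, since Df(x) is invertible for a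
   diffeomorphism. Under generalized hyperbolicity this preimage lies in the range of Q x, the kernel
   of P x, so the sum is automatically direct. *)
definition stable_unstable_sum ::
  "('a::banach \<Rightarrow> 'a) \<Rightarrow> ('a \<Rightarrow> 'a \<Rightarrow>\<^sub>L 'a) \<Rightarrow> ('a \<Rightarrow> 'a \<Rightarrow>\<^sub>L 'a) \<Rightarrow> 'a \<Rightarrow> 'a set" where
  "stable_unstable_sum f P Q x = range (P x) + fderiv f x -` range (Q (f x))"

definition semiconj_pair ::
  "('a::banach \<Rightarrow> 'a) \<Rightarrow> ('a \<Rightarrow> 'a) \<Rightarrow> real \<Rightarrow> ('a \<Rightarrow> 'a) \<Rightarrow> ('a \<Rightarrow> 'a) \<Rightarrow> bool" where
  "semiconj_pair f g c h1 h2 \<longleftrightarrow>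
     uniformly_continuous_on UNIV h1 \<and> uniformly_continuous_on UNIV h2 \<and>
     g \<circ> Id_plus h1 = Id_plus h1 \<circ> f \<and>
     f \<circ> Id_plus h2 = Id_plus h2 \<circ> g \<and>
     (\<forall>x. norm (h1 x) < c \<and> norm (h2 x) < c)"

end

(* A conjugacy Id + h between a base map phi and a target psi, both close to f, is a solution of
   T h = psi(. + h) - phi - Df h, where T h (phi x) = h (phi x) - Df(x) h(x). For f itself, T has the
   right inverse w |-> (sum over n >= 0 of Df^n P w) - (sum over n >= 1 of Df^-n Q w), taken along
   orbits. Truncating both sums at a large fixed N and following the orbits of phi while keeping the
   derivatives of f^n and f^-n leaves an approximate right inverse of T, with error below 1/2, whether
   phi = f or phi = g; a contraction argument in the bounded uniformly continuous functions then gives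
   both semiconjugacies.

   The truncated sums take values in the sum of E^s_x and Df(x)^-1 E^u_(f x) at suitable points x, and
   on functions with values in that space T is bounded below. If the space F is the same for all x,
   then Id + h1 and Id + h2 compose to Id + k with k small, F-valued and Id + k commuting with f or g,
   which forces k = 0. *)
theory Submission
  imports Defs
begin

text \<open>The inclusions in (GH2) may be strict: a nonzero vector of E^s_(f x) may lie in Df(x)
  E^u_x, and it then decays in both time directions. So T need not be injective, a right inverse is
  all one can ask for, and the two semiconjugacies need not be inverse to each other. E^s_x +
  Df(x)^-1 E^u_(f x) consists of the vectors whose unstable component stays unstable under Df(x);
  this is what restores injectivity.

  No splitting is constructed for g: contraction is known only for iterates of f, so vectors sitting
  on a g-orbit are moved by derivatives of f^n based at its points. The f-orbit of such a point
  leaves the g-orbit by up to n R^n d after n steps, which forces finite sums: N depends on C, lam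
  and R alone, the closeness of g to f is chosen after N.

  An approximate right inverse L suffices because the unknown is w with h = L w, and the fixed point
  equation for w is the exact conjugacy equation for h. The linear error costs 1/2, the nonlinear
  remainder 1/4; hence the rate 3/4 in existence and in uniqueness.\<close>

abbreviation uc :: "('a::metric_space \<Rightarrow> 'b::metric_space) \<Rightarrow> bool" where
  "uc \<equiv> uniformly_continuous_on UNIV"

section \<open>Uniformly continuous maps, operator bounds and a fixed point principle\<close>

lemma uc_compose: "uc h \<Longrightarrow> uc k \<Longrightarrow> uc (\<lambda>x. k (h x))"
  unfolding uniformly_continuous_on_def by (metis UNIV_I)

lemma uc_lipschitz:
  fixes h :: "'a::real_normed_vector \<Rightarrow> 'b::real_normed_vector"
  assumes "\<And>x y. norm (h x - h y) \<le> B * norm (x - y)"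
  shows "uc h"
proof -
  have B: "norm (h x - h y) \<le> (\<bar>B\<bar> + 1) * norm (x - y)" for x y
    by (rule order_trans[OF assms]) (intro mult_right_mono, auto)
  show ?thesis
    unfolding uniformly_continuous_on_def
  proof (intro allI impI)
    fix e :: real assume e: "e > 0"
    show "\<exists>d>0. \<forall>x\<in>UNIV. \<forall>x'\<in>UNIV. dist x' x < d \<longrightarrow> dist (h x') (h x) < e"
    proof (intro exI conjI ballI impI)
      show "e / (\<bar>B\<bar> + 1) > 0" using e by simp
      fix x x' :: 'a assume "dist x' x < e / (\<bar>B\<bar> + 1)"
      then have "(\<bar>B\<bar> + 1) * norm (x' - x) < e"
        by (simp add: dist_norm pos_less_divide_eq mult.commute)
      with B[of x' x] show "dist (h x') (h x) < e" by (simp add: dist_norm)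
    qed
  qed
qed

lemma uc_funpow:
  fixes h :: "'a::metric_space \<Rightarrow> 'a"
  shows "uc h \<Longrightarrow> uc (h ^^ n)"
proof (induction n)
  case 0
  have "h ^^ 0 = (\<lambda>x. x)" by auto
  then show ?case using uniformly_continuous_on_id by metis
next
  case (Suc n)
  then show ?case using uc_compose[of "h ^^ n" h] by (simp add: comp_def)
qed

text \<open>The bounds on the factors matter: the square is not uniformly continuous on the reals.
  The \<open>+ 1\<close> in \<open>e'\<close> keeps its denominator positive when \<open>a\<close>
  and \<open>b\<close> both vanish.\<close>

lemma (in bounded_bilinear) uc_prod:
  fixes h :: "'d::metric_space \<Rightarrow> 'a" and k :: "'d \<Rightarrow> 'b"
  assumes h: "uc h" "\<And>x. norm (h x) \<le> a" and k: "uc k" "\<And>x. norm (k x) \<le> b"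
  shows "uc (\<lambda>x. prod (h x) (k x))"
proof -
  obtain K where K: "K > 0" "\<And>u v. norm (prod u v) \<le> norm u * norm v * K"
    using pos_bounded by blast
  have a: "a \<ge> 0" and b: "b \<ge> 0"
    using h(2) k(2) norm_ge_zero order_trans by blast+
  show ?thesis
    unfolding uniformly_continuous_on_def
  proof (intro allI impI)
    fix e :: real assume e: "e > 0"
    define e' where "e' = e / (2 * K * (a + b + 1))"
    have e': "e' > 0" using e K(1) a b by (simp add: e'_def)
    obtain d1 where d1: "d1 > 0" "\<And>x y. dist y x < d1 \<Longrightarrow> dist (h y) (h x) < e'"
      using h(1) e' unfolding uniformly_continuous_on_def by (metis UNIV_I)
    obtain d2 where d2: "d2 > 0" "\<And>x y. dist y x < d2 \<Longrightarrow> dist (k y) (k x) < e'"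
      using k(1) e' unfolding uniformly_continuous_on_def by (metis UNIV_I)
    show "\<exists>d>0. \<forall>x\<in>UNIV. \<forall>y\<in>UNIV. dist y x < d \<longrightarrow> dist (prod (h y) (k y)) (prod (h x) (k x)) < e"
    proof (intro exI conjI ballI impI)
      show "min d1 d2 > 0" using d1 d2 by simp
      fix x y :: 'd assume "dist y x < min d1 d2"
      then have hk: "norm (h y - h x) \<le> e'" "norm (k y - k x) \<le> e'"
        using d1(2)[of y x] d2(2)[of y x] by (auto simp: dist_norm)
      have "prod (h y) (k y) - prod (h x) (k x) = prod (h y - h x) (k y) + prod (h x) (k y - k x)"
        by (simp add: diff_left diff_right)
      also have "norm \<dots> \<le> norm (h y - h x) * norm (k y) * K + norm (h x) * norm (k y - k x) * K"
        by (intro norm_triangle_le add_mono K)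
      also have "\<dots> \<le> e' * b * K + a * e' * K"
        using hk h(2) k(2) a b e' K(1) by (intro add_mono mult_mono) auto
      also have "\<dots> = e' * (K * (a + b))" by (simp add: algebra_simps)
      also have "\<dots> \<le> e' * (K * (a + b + 1))" using e' K(1) by (intro mult_left_mono) auto
      also have "\<dots> = e / 2" unfolding e'_def using K(1) a b by (auto simp: field_simps add_nonneg_eq_0_iff)
      finally show "dist (prod (h y) (k y)) (prod (h x) (k x)) < e"
        using e by (simp add: dist_norm)
    qed
  qed
qed

lemmas uc_blinfun_apply = bounded_bilinear.uc_prod[OF bounded_bilinear_blinfun_apply]
lemmas uc_blinfun_compose = bounded_bilinear.uc_prod[OF bounded_bilinear_blinfun_compose]

lemma norm_blinfun_le:
  assumes "norm B \<le> b" "norm v \<le> c"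
  shows "norm (blinfun_apply B v) \<le> b * c"
proof -
  have "norm (blinfun_apply B v) \<le> norm B * norm v" by (rule norm_blinfun)
  also have "\<dots> \<le> b * c" using assms by (intro mult_mono) (auto intro: order_trans[OF norm_ge_zero])
  finally show ?thesis .
qed

lemma norm_blinfun_compose_le':
  assumes "norm B \<le> b" "norm D \<le> c"
  shows "norm (B o\<^sub>L D) \<le> b * c"
proof -
  have "norm (B o\<^sub>L D) \<le> norm B * norm D" by (rule norm_blinfun_compose)
  also have "\<dots> \<le> b * c" using assms by (intro mult_mono) (auto intro: order_trans[OF norm_ge_zero])
  finally show ?thesis .
qed

text \<open>Each step multiplies the gap by at most \<open>R\<close> and adds at most
  \<open>d\<close>; \<open>n * R ^ n\<close> dominates the resulting geometric sum. Only the
  Lipschitz constant of \<open>f\<close> enters, so one bound serves all perturbations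
  \<open>g\<close>.\<close>

lemma funpow_lipschitz_close:
  fixes f :: "'a::real_normed_vector \<Rightarrow> 'a"
  assumes lip: "\<And>x y. norm (f x - f y) \<le> R * norm (x - y)" and R: "1 \<le> R"
    and close: "\<And>x. norm (f x - g x) \<le> d"
  shows "norm ((f ^^ n) x - (g ^^ n) x) \<le> of_nat n * R ^ n * d"
proof (induction n)
  case 0
  show ?case by simp
next
  case (Suc n)
  have d: "0 \<le> d" using close[of x] norm_ge_zero order_trans by blast
  have R1: "1 \<le> R ^ Suc n" using R one_le_power by blast
  have "(f ^^ Suc n) x - (g ^^ Suc n) x
      = (f ((f ^^ n) x) - f ((g ^^ n) x)) + (f ((g ^^ n) x) - g ((g ^^ n) x))" by simp
  also have "norm \<dots> \<le> R * (of_nat n * R ^ n * d) + d"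
    by (intro norm_triangle_le add_mono close order_trans[OF lip] mult_left_mono Suc.IH) (use R in auto)
  also have "\<dots> \<le> of_nat n * R ^ Suc n * d + R ^ Suc n * d"
    using mult_right_mono[OF R1 d] by (simp add: algebra_simps)
  also have "\<dots> = of_nat (Suc n) * R ^ Suc n * d" by (simp add: algebra_simps)
  finally show ?case .
qed

text \<open>Banach's theorem on a closed set of bounded continuous functions: uniform continuity and
  the bound \<open>\<rho>\<close> survive uniform limits. Contraction is phrased with an arbitrary
  pointwise bound \<open>a\<close>, so that applications deal with plain functions and no supremum
  norm; in the proof \<open>a\<close> becomes the distance.\<close>

lemma bounded_uc_fixed_point:
  fixes F :: "('a::metric_space \<Rightarrow> 'b::banach) \<Rightarrow> 'a \<Rightarrow> 'b"
  assumes \<rho>: "0 \<le> \<rho>" and c: "0 \<le> c" "c < 1"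
    and self: "\<And>w. uc w \<Longrightarrow> (\<And>x. norm (w x) \<le> \<rho>) \<Longrightarrow> uc (F w) \<and> (\<forall>x. norm (F w x) \<le> \<rho>)"
    and contr: "\<And>w v a x. uc w \<Longrightarrow> (\<And>x. norm (w x) \<le> \<rho>) \<Longrightarrow> uc v \<Longrightarrow> (\<And>x. norm (v x) \<le> \<rho>) \<Longrightarrow>
       (\<And>x. norm (w x - v x) \<le> a) \<Longrightarrow> norm (F w x - F v x) \<le> c * a"
  obtains w where "uc w" "\<And>x. norm (w x) \<le> \<rho>" "F w = w"
proof -
  define S where "S = {w :: 'a \<Rightarrow>\<^sub>C 'b. uc (apply_bcontfun w) \<and> (\<forall>x. norm (apply_bcontfun w x) \<le> \<rho>)}"
  define G where "G w = Bcontfun (F (apply_bcontfun w))" for w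
  have mem: "w \<in> bcontfun" if "uc w" "\<And>x. norm (w x) \<le> \<rho>" for w :: "'a \<Rightarrow> 'b"
    using that by (intro bcontfun_normI uniformly_continuous_imp_continuous)
  have G: "apply_bcontfun (G w) = F (apply_bcontfun w)" if "w \<in> S" for w
    unfolding G_def using that self[of "apply_bcontfun w"]
    by (intro Bcontfun_inverse mem) (auto simp: S_def)
  have "complete S"
  proof (subst complete_eq_closed, subst closed_sequential_limits, intro allI impI, elim conjE)
    fix u :: "nat \<Rightarrow> 'a \<Rightarrow>\<^sub>C 'b" and l
    assume u: "\<forall>n. u n \<in> S" and l: "u \<longlonglongrightarrow> l"
    have "uc (apply_bcontfun l)"
      unfolding uniformly_continuous_on_def
    proof (intro allI impI)
      fix e :: real assume e: "e > 0"
      then obtain n where n: "dist (u n) l < e / 3"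
        using l unfolding lim_sequentially by (metis zero_less_divide_iff zero_less_numeral order_refl)
      from u have "uc (apply_bcontfun (u n))" by (simp add: S_def)
      then obtain d where d: "d > 0" "\<And>x y. dist y x < d \<Longrightarrow> dist (u n y) (u n x) < e / 3"
        using e unfolding uniformly_continuous_on_def
        by (metis UNIV_I zero_less_divide_iff zero_less_numeral)
      show "\<exists>d>0. \<forall>x\<in>UNIV. \<forall>y\<in>UNIV. dist y x < d \<longrightarrow> dist (apply_bcontfun l y) (apply_bcontfun l x) < e"
      proof (intro exI conjI ballI impI)
        show "d > 0" by fact
        fix x y :: 'a assume "dist y x < d"
        then have "dist (u n y) (u n x) < e / 3" by (rule d)
        moreover have "dist (u n y) (l y) < e / 3" "dist (u n x) (l x) < e / 3"
          using n dist_bounded[of "u n" _ l] le_less_trans by blast+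
        ultimately show "dist (apply_bcontfun l y) (apply_bcontfun l x) < e"
          using dist_triangle[of "l y" "l x" "u n y"] dist_triangle[of "u n y" "l x" "u n x"]
          by (simp add: dist_commute)
      qed
    qed
    moreover have "norm (apply_bcontfun l x) \<le> \<rho>" for x
    proof (rule Lim_norm_ubound)
      have "uniform_limit UNIV (\<lambda>n. apply_bcontfun (u n)) (apply_bcontfun l) sequentially"
        using l by (simp add: tendsto_bcontfun_uniform_limit)
      then show "(\<lambda>n. u n x) \<longlonglongrightarrow> l x" by (rule tendsto_uniform_limitI) simp
      show "\<forall>\<^sub>F n in sequentially. norm (apply_bcontfun (u n) x) \<le> \<rho>" using u by (auto simp: S_def)
    qed simp
    ultimately show "l \<in> S" by (simp add: S_def)
  qed
  moreover have "0 \<in> S" using \<rho> by (simp add: S_def uniformly_continuous_on_const)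
  then have "S \<noteq> {}" by blast
  moreover have "G ` S \<subseteq> S"
    using self by (auto simp: G S_def[symmetric]) (auto simp: S_def G[unfolded S_def])
  moreover have "dist (G w) (G v) \<le> c * dist w v" if "w \<in> S" "v \<in> S" for w v
  proof (rule dist_bound)
    fix x
    have "norm (F w x - F v x) \<le> c * dist w v"
      by (rule contr) (use that dist_bounded[of w _ v] in \<open>auto simp: S_def dist_norm\<close>)
    then show "dist (apply_bcontfun (G w) x) (apply_bcontfun (G v) x) \<le> c * dist w v"
      using that by (simp add: G dist_norm)
  qed
  ultimately have "\<exists>!w\<in>S. G w = w"
    using c by (intro Banach_fix) auto
  then obtain w where "w \<in> S" "G w = w" by blast
  then show ?thesis using that[of w] G[of w] by (simp add: S_def)
qed

section \<open>Cocycles and truncated sums along orbits: one half of the splitting\<close>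

lemma funpow_cancel:
  fixes \<phi> \<phi>i :: "'a \<Rightarrow> 'a"
  assumes "\<And>x. \<phi> (\<phi>i x) = x"
  shows "(\<phi> ^^ n) ((\<phi>i ^^ n) x) = x"
  by (induction n arbitrary: x) (simp_all add: funpow_swap1[of \<phi>] assms)

text \<open>For \<open>A\<close> the derivative of \<open>f\<close> this is the chain-rule product
  for \<open>f ^^ n\<close>. With \<open>A\<close> abstract, the estimates below rest on bounds and
  uniform continuity only.\<close>

primrec cocycle :: "('a \<Rightarrow> 'a) \<Rightarrow> ('a \<Rightarrow> 'a \<Rightarrow>\<^sub>L 'a) \<Rightarrow> nat \<Rightarrow> 'a \<Rightarrow> 'a::real_normed_vector \<Rightarrow>\<^sub>L 'a" where
  "cocycle f A 0 x = id_blinfun"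
| "cocycle f A (Suc n) x = A ((f ^^ n) x) o\<^sub>L cocycle f A n x"

lemma fderiv_eqI: "(f has_derivative blinfun_apply B) (at x) \<Longrightarrow> fderiv f x = B"
  unfolding fderiv_def by (simp add: frechet_derivative_at[symmetric] blinfun_apply_inverse)

lemma fderiv_funpow:
  assumes "\<And>x. f differentiable (at x)"
  shows "fderiv (f ^^ n) x = cocycle f (fderiv f) n x"
proof (rule fderiv_eqI, induction n)
  case 0
  have "f ^^ 0 = (\<lambda>x. x)" by auto
  then show ?case by simp
next
  case (Suc n)
  have "(f \<circ> f ^^ n has_derivative fderiv f ((f ^^ n) x) \<circ> cocycle f (fderiv f) n x) (at x)"
    by (intro diff_chain_at Suc fderiv_works assms)
  then show ?case by (simp add: comp_def)
qed

text \<open>Time reversal turns the unstable half of the splitting into a stable one, so the locale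
  is instantiated twice: with \<open>f\<close>, its derivative and \<open>P\<close>, and with the
  inverse, its derivative and \<open>Q\<close>. The condition \<open>1 \<le> R\<close> makes the
  powers of \<open>R\<close> monotone.\<close>

locale contracting_cocycle =
  fixes f :: "'a::banach \<Rightarrow> 'a" and A P :: "'a \<Rightarrow> 'a \<Rightarrow>\<^sub>L 'a" and C lam R :: real
  assumes const_bounds: "1 \<le> R" "0 < C" "0 < lam" "lam < 1"
    and lip: "\<And>x y. norm (f x - f y) \<le> R * norm (x - y)"
    and norm_A: "\<And>x. norm (A x) \<le> R"
    and uc_A: "uc A"
    and norm_P: "\<And>x. norm (P x) \<le> C"
    and uc_P: "uc P"
    and idem: "\<And>x v. P x (P x v) = P x v"
    and range_A: "\<And>x v. v \<in> range (P x) \<Longrightarrow> A x v \<in> range (P (f x))"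
    and contraction: "\<And>n x v. 0 < n \<Longrightarrow> v \<in> range (P x) \<Longrightarrow>
          norm (cocycle f A n x v) \<le> C * lam ^ n * norm v"
begin

lemma uc_f: "uc f"
  by (rule uc_lipschitz[OF lip])

lemma norm_P_apply: "norm v \<le> a \<Longrightarrow> norm (P x v) \<le> C * a"
  by (intro norm_blinfun_le norm_P)

lemma norm_cocycle: "norm (cocycle f A n x) \<le> R ^ n"
proof (induction n)
  case 0
  show ?case by (simp add: norm_blinfun_id_le)
next
  case (Suc n)
  show ?case using norm_blinfun_compose_le'[OF norm_A Suc] by simp
qed

lemma norm_cocycle_apply: "norm v \<le> a \<Longrightarrow> norm (cocycle f A n x v) \<le> R ^ n * a"
  by (intro norm_blinfun_le norm_cocycle)

lemma uc_cocycle: "uc (cocycle f A n)"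
proof (induction n)
  case 0
  then show ?case by (simp add: uniformly_continuous_on_const)
next
  case (Suc n)
  have "uc (\<lambda>x. A ((f ^^ n) x) o\<^sub>L cocycle f A n x)"
    by (intro uc_blinfun_compose[where a = R and b = "R ^ n"] norm_A norm_cocycle Suc
          uc_compose[OF uc_funpow[OF uc_f] uc_A])
  then show ?case by simp
qed

lemma cocycle_range: "v \<in> range (P x) \<Longrightarrow> cocycle f A n x v \<in> range (P ((f ^^ n) x))"
  by (induction n) (auto intro: range_A)

text \<open>A truncated approximate Neumann series for
  \<open>S x = p x + A (\<phi>i x) (S (\<phi>i x))\<close>. The base points run backwards along the
  orbit of the perturbed map, while each operator is a cocycle of \<open>f\<close> started there,
  the only kind to which \<open>contraction\<close> applies.\<close>

definition orbit_sum :: "nat \<Rightarrow> ('a \<Rightarrow> 'a) \<Rightarrow> ('a \<Rightarrow> 'a) \<Rightarrow> 'a \<Rightarrow> 'a" where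
  "orbit_sum N \<phi>i p x = (\<Sum>n<N. cocycle f A n ((\<phi>i ^^ n) x) (p ((\<phi>i ^^ n) x)))"

text \<open>Used with \<open>z\<close> the n-th preimage of a point y under \<open>\<phi>\<close>:
  then the second operator is \<open>A\<close> at y, and the first is the next factor of the cocycle
  of \<open>f\<close> started at \<open>z\<close>.\<close>

definition drift :: "('a \<Rightarrow> 'a) \<Rightarrow> nat \<Rightarrow> real \<Rightarrow> bool" where
  "drift \<phi> N e \<longleftrightarrow> (\<forall>n\<le>N. \<forall>z. norm (A ((f ^^ n) z) - A ((\<phi> ^^ n) z)) \<le> e)"

lemma drift_if_close:
  assumes "0 < e"
  obtains d0 where "0 < d0"
    "\<And>\<phi>. (\<And>x. norm (f x - \<phi> x) \<le> d0) \<Longrightarrow> drift \<phi> N e"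
proof -
  obtain \<delta> where \<delta>: "\<delta> > 0" "\<And>x y. dist y x < \<delta> \<Longrightarrow> dist (A y) (A x) < e"
    using uc_A assms unfolding uniformly_continuous_on_def by (metis UNIV_I)
  \<comment> \<open>By \<open>funpow_lipschitz_close\<close> the orbits separate by at most
    \<open>n * R ^ n * d0\<close>. The factor \<open>N + 1\<close> avoids division by zero for
    \<open>N = 0\<close>, and half of \<open>\<delta>\<close> yields a strict inequality.\<close>
  define d0 where "d0 = \<delta> / 2 / ((real N + 1) * R ^ N)"
  have R: "R ^ N \<ge> 1" using const_bounds by simp
  have d0: "d0 > 0" using \<delta> R by (simp add: d0_def)
  have "drift \<phi> N e" if "\<And>x. norm (f x - \<phi> x) \<le> d0" for \<phi>
    unfolding drift_def
  proof (intro allI impI)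
    fix n z assume n: "n \<le> N"
    have "norm ((f ^^ n) z - (\<phi> ^^ n) z) \<le> real n * R ^ n * d0"
      using funpow_lipschitz_close[OF lip const_bounds(1) that] by simp
    also have "\<dots> \<le> (real N + 1) * R ^ N * d0"
      using n d0 const_bounds by (intro mult_mono power_increasing) auto
    also have "\<dots> = \<delta> / 2"
    proof -
      have "(real N + 1) * R ^ N \<noteq> 0" using const_bounds by auto
      then show ?thesis unfolding d0_def by (metis nonzero_mult_div_cancel_left times_divide_eq_right)
    qed
    finally have "dist ((f ^^ n) z) ((\<phi> ^^ n) z) < \<delta>" using \<delta>(1) by (simp add: dist_norm)
    from \<delta>(2)[OF this] show "norm (A ((f ^^ n) z) - A ((\<phi> ^^ n) z)) \<le> e"
      by (simp add: dist_norm)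
  qed
  with d0 show ?thesis by (rule that)
qed

text \<open>The crude growth \<open>R ^ N\<close> is affordable because \<open>N\<close> is fixed
  before the size of the perturbation.\<close>

lemma orbit_sum_bound:
  assumes p: "\<And>x. norm (p x) \<le> a"
  shows "norm (orbit_sum N \<phi>i p x) \<le> real N * R ^ N * a"
proof -
  have a: "0 \<le> a" using p norm_ge_zero order_trans by blast
  have "norm (orbit_sum N \<phi>i p x) \<le> (\<Sum>n<N. R ^ N * a)"
    unfolding orbit_sum_def
  proof (rule sum_norm_le)
    fix n assume "n \<in> {..<N}"
    then have "R ^ n * a \<le> R ^ N * a"
      using a const_bounds by (intro mult_right_mono power_increasing) auto
    then show "norm (cocycle f A n ((\<phi>i ^^ n) x) (p ((\<phi>i ^^ n) x))) \<le> R ^ N * a"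
      using norm_cocycle_apply[OF p] order_trans by blast
  qed
  then show ?thesis by simp
qed

lemma uc_orbit_sum:
  assumes "uc \<phi>i" "uc p" "\<And>x. norm (p x) \<le> a"
  shows "uc (orbit_sum N \<phi>i p)"
  unfolding orbit_sum_def[abs_def]
proof (rule uniformly_continuous_on_sum)
  fix n
  show "uc (\<lambda>x. cocycle f A n ((\<phi>i ^^ n) x) (p ((\<phi>i ^^ n) x)))"
    by (rule uc_blinfun_apply[where a = "R ^ n" and b = a])
      (intro uc_compose[OF uc_funpow] uc_cocycle assms norm_cocycle)+
qed

lemma orbit_sum_diff:
  "orbit_sum N \<phi>i p x - orbit_sum N \<phi>i q x = orbit_sum N \<phi>i (\<lambda>x. p x - q x) x"
  by (simp add: orbit_sum_def blinfun.diff_right sum_subtractf)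

text \<open>Telescoping: applying \<open>A (\<phi>i x)\<close> to the sum at
  \<open>\<phi>i x\<close> gives the terms of index n + 1 at \<open>x\<close>, up to errors
  \<open>E n\<close>. What survives is the last term \<open>T N\<close>, small by contraction, and
  the errors. In \<open>E n\<close> the operator \<open>A\<close> is compared at
  \<open>\<phi>i x\<close>, the n-th \<open>\<phi>\<close>-image of \<open>z n\<close>, and at the
  n-th \<open>f\<close>-image of \<open>z n\<close>, which is what \<open>drift\<close>
  bounds.\<close>

lemma orbit_sum_approx:
  assumes N: "0 < N" and inv: "\<And>x. \<phi> (\<phi>i x) = x" and drift: "drift \<phi> N e"
    and p: "\<And>x. norm (p x) \<le> a" "\<And>x. p x \<in> range (P x)"
  shows "norm (p x - orbit_sum N \<phi>i p x + A (\<phi>i x) (orbit_sum N \<phi>i p (\<phi>i x)))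
           \<le> (C * lam ^ N + real N * R ^ N * e) * a"
proof -
  have a: "0 \<le> a" using p(1) norm_ge_zero order_trans by blast
  have e: "0 \<le> e" using drift norm_ge_zero order_trans unfolding drift_def by blast
  define T where "T n = cocycle f A n ((\<phi>i ^^ n) x) (p ((\<phi>i ^^ n) x))" for n
  define z where "z n = (\<phi>i ^^ n) (\<phi>i x)" for n
  define E where "E n = (A (\<phi>i x) - A ((f ^^ n) (z n))) (cocycle f A n (z n) (p (z n)))" for n
  have z: "(\<phi>i ^^ Suc n) x = z n" for n by (simp add: z_def funpow_swap1)
  have "E n = A (\<phi>i x) (cocycle f A n (z n) (p (z n))) - T (Suc n)" for n
    unfolding E_def T_def z by (simp add: blinfun.diff_left)
  then have eq1: "A (\<phi>i x) (orbit_sum N \<phi>i p (\<phi>i x)) = (\<Sum>n<N. E n) + (\<Sum>n<N. T (Suc n))"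
    by (simp add: sum_subtractf orbit_sum_def z_def blinfun.sum_right)
  have eq2: "orbit_sum N \<phi>i p x = p x + (\<Sum>n<N. T (Suc n)) - T N"
    using sum.lessThan_Suc_shift[of T N] by (simp add: orbit_sum_def T_def eq_diff_eq)
  have "p x - orbit_sum N \<phi>i p x + A (\<phi>i x) (orbit_sum N \<phi>i p (\<phi>i x)) = T N + (\<Sum>n<N. E n)"
    unfolding eq1 eq2 by simp
  also have "norm \<dots> \<le> C * lam ^ N * a + (\<Sum>n<N. e * (R ^ N * a))"
  proof (intro norm_triangle_le add_mono sum_norm_le)
    have "norm (T N) \<le> C * lam ^ N * norm (p ((\<phi>i ^^ N) x))"
      unfolding T_def by (intro contraction N p)
    also have "\<dots> \<le> C * lam ^ N * a" using const_bounds by (intro mult_left_mono p) auto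
    finally show "norm (T N) \<le> C * lam ^ N * a" .
  next
    fix n assume n: "n \<in> {..<N}"
    have "norm (A ((f ^^ n) (z n)) - A ((\<phi> ^^ n) (z n))) \<le> e"
      using drift n unfolding drift_def by (meson lessThan_iff less_imp_le)
    then have "norm (A (\<phi>i x) - A ((f ^^ n) (z n))) \<le> e"
      unfolding z_def funpow_cancel[where \<phi> = \<phi> and \<phi>i = \<phi>i, OF inv] by (simp add: norm_minus_commute)
    then have "norm (E n) \<le> e * (R ^ n * a)"
      unfolding E_def by (intro norm_blinfun_le norm_cocycle_apply p)
    also have "\<dots> \<le> e * (R ^ N * a)"
      using n a e const_bounds by (intro mult_left_mono mult_right_mono power_increasing) auto
    finally show "norm (E n) \<le> e * (R ^ N * a)" .
  qed
  finally show ?thesis by (simp add: algebra_simps)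
qed

text \<open>If \<open>s\<close> is nearly carried along by \<open>A\<close>, then \<open>s x\<close>
  is close to the \<open>N\<close>-step cocycle applied to \<open>s\<close> at the point
  \<open>N\<close> steps back, and there contraction gains the factor \<open>C * lam ^ N\<close>.
  This is the quantitative form of the fact that a bounded invariant stable field vanishes.\<close>

lemma almost_invariant_bound:
  assumes N: "0 < N" and inv: "\<And>x. \<phi> (\<phi>i x) = x" and drift: "drift \<phi> N e"
    and s: "\<And>x. norm (s x) \<le> a" "\<And>x. s x \<in> range (P x)"
    and c: "\<And>x. norm (s x - A (\<phi>i x) (s (\<phi>i x))) \<le> c"
  shows "norm (s x) \<le> C * lam ^ N * a + real N * R ^ N * (c + e * a)"
proof -
  have a: "0 \<le> a" using s(1) norm_ge_zero order_trans by blast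
  have c0: "0 \<le> c" using c norm_ge_zero order_trans by blast
  have e: "0 \<le> e" using drift norm_ge_zero order_trans unfolding drift_def by blast
  have *: "norm (s x - cocycle f A n ((\<phi>i ^^ n) x) (s ((\<phi>i ^^ n) x))) \<le> real n * R ^ n * (c + e * a)"
    if "n \<le> N" for n x
    using that
  proof (induction n arbitrary: x)
    case 0
    show ?case by simp
  next
    case (Suc n)
    define z where "z = (\<phi>i ^^ n) (\<phi>i x)"
    define t where "t = cocycle f A n z (s z)"
    have z: "(\<phi>i ^^ Suc n) x = z" by (simp add: z_def funpow_swap1)
    have R1: "1 \<le> R ^ Suc n" "R ^ n \<le> R ^ Suc n" using const_bounds by (auto intro!: one_le_power power_increasing simp del: power_Suc)
    have "norm (A ((f ^^ n) z) - A ((\<phi> ^^ n) z)) \<le> e"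
      using drift Suc.prems unfolding drift_def by (meson Suc_leD)
    then have d: "norm (A (\<phi>i x) - A ((f ^^ n) z)) \<le> e"
      unfolding z_def funpow_cancel[where \<phi> = \<phi> and \<phi>i = \<phi>i, OF inv] by (simp add: norm_minus_commute)
    \<comment> \<open>Three errors: the one-step defect at \<open>x\<close>, the error accumulated
      up to \<open>\<phi>i x\<close> and pushed forward by \<open>A\<close>, and the drift of the
      last factor of the cocycle.\<close>
    have "s x - cocycle f A (Suc n) z (s z)
        = (s x - A (\<phi>i x) (s (\<phi>i x))) + A (\<phi>i x) (s (\<phi>i x) - t) + (A (\<phi>i x) - A ((f ^^ n) z)) t"
      by (simp add: t_def blinfun.diff_left blinfun.diff_right)
    also have "norm \<dots> \<le> c + R * (real n * R ^ n * (c + e * a)) + e * (R ^ n * a)"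
      using Suc.IH[of "\<phi>i x"] Suc.prems
      by (intro norm_triangle_le add_mono c norm_blinfun_le norm_A d)
         (auto simp: t_def z_def norm_cocycle_apply s)
    also have "\<dots> \<le> R ^ Suc n * c + R * (real n * R ^ n * (c + e * a)) + e * (R ^ Suc n * a)"
      using mult_right_mono[OF R1(1) c0] a e const_bounds by (intro add_mono mult_left_mono mult_right_mono R1) auto
    also have "\<dots> = real (Suc n) * R ^ Suc n * (c + e * a)" by (simp add: algebra_simps)
    finally show ?case unfolding z .
  qed
  have "norm (cocycle f A N ((\<phi>i ^^ N) x) (s ((\<phi>i ^^ N) x))) \<le> C * lam ^ N * norm (s ((\<phi>i ^^ N) x))"
    by (intro contraction N s)
  also have "\<dots> \<le> C * lam ^ N * a" using const_bounds by (intro mult_left_mono s) auto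
  finally show ?thesis using *[OF order_refl, of x] norm_triangle_sub by (smt (verit))
qed

end

section \<open>The two-sided splitting: approximate right inverse and lower bound for T\<close>

locale hyperbolic_splitting =
  fwd: contracting_cocycle f A P C lam R + bwd: contracting_cocycle fi Ai Q C lam R
  for f fi :: "'a::banach \<Rightarrow> 'a" and A Ai P Q C lam R +
  assumes f_fi: "\<And>x. f (fi x) = x" and fi_f: "\<And>x. fi (f x) = x"
    and A_Ai: "\<And>x v. A (fi x) (Ai x v) = v" and Ai_A: "\<And>x v. Ai (f x) (A x v) = v"
    and PQ: "\<And>x v. P x v + Q x v = v"
begin

text \<open>Every closeness that the linear estimates require, for one map. It holds for
  \<open>f\<close> itself as well as for maps near \<open>f\<close>, so both semiconjugacies come
  from the same lemma with the roles of base and target exchanged.\<close>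

definition perturbed :: "('a \<Rightarrow> 'a) \<Rightarrow> ('a \<Rightarrow> 'a) \<Rightarrow> nat \<Rightarrow> real \<Rightarrow> bool" where
  "perturbed \<phi> \<phi>i N e \<longleftrightarrow>
     (\<forall>x. \<phi> (\<phi>i x) = x \<and> \<phi>i (\<phi> x) = x) \<and> uc \<phi> \<and> uc \<phi>i \<and>
     fwd.drift \<phi> N e \<and> bwd.drift \<phi>i N e \<and>
     (\<forall>x. norm (A (\<phi>i x) - A (fi x)) \<le> e \<and> norm (Ai (f x) - Ai (\<phi> x)) \<le> e \<and>
          norm (P (\<phi> x) - P (f x)) \<le> e \<and> norm (Q (\<phi> x) - Q (f x)) \<le> e)"

lemma perturbed_if_close:
  assumes "0 < e"
  obtains d0 where "0 < d0"
    "\<And>\<phi> \<phi>i. (\<And>x. \<phi> (\<phi>i x) = x) \<Longrightarrow> (\<And>x. \<phi>i (\<phi> x) = x) \<Longrightarrow> uc \<phi> \<Longrightarrow> uc \<phi>i \<Longrightarrow>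
       (\<And>x. norm (f x - \<phi> x) \<le> d0) \<Longrightarrow> perturbed \<phi> \<phi>i N e"
proof -
  have R: "1 \<le> R" by (rule fwd.const_bounds)
  obtain d1 where d1: "0 < d1" "\<And>\<phi>. (\<And>x. norm (f x - \<phi> x) \<le> d1) \<Longrightarrow> fwd.drift \<phi> N e"
    using fwd.drift_if_close[OF assms] by blast
  obtain d2 where d2: "0 < d2" "\<And>\<phi>. (\<And>x. norm (fi x - \<phi> x) \<le> d2) \<Longrightarrow> bwd.drift \<phi> N e"
    using bwd.drift_if_close[OF assms] by blast
  have unif: "\<exists>\<delta>>0. \<forall>x y. norm (y - x) \<le> \<delta> \<longrightarrow> norm (B y - B x) \<le> e"
    if uB: "uc B" for B :: "'a \<Rightarrow> 'a \<Rightarrow>\<^sub>L 'a"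
  proof -
    obtain \<delta> where "\<delta> > 0" "\<And>x y. dist y x < \<delta> \<Longrightarrow> dist (B y) (B x) < e"
      using uB assms unfolding uniformly_continuous_on_def by (metis UNIV_I)
    then show ?thesis by (intro exI[of _ "\<delta> / 2"]) (force simp: dist_norm less_imp_le)
  qed
  obtain a1 where a1: "0 < a1" "\<And>x y. norm (y - x) \<le> a1 \<Longrightarrow> norm (A y - A x) \<le> e"
    using unif[OF fwd.uc_A] by blast
  obtain a2 where a2: "0 < a2" "\<And>x y. norm (y - x) \<le> a2 \<Longrightarrow> norm (Ai y - Ai x) \<le> e"
    using unif[OF bwd.uc_A] by blast
  obtain a3 where a3: "0 < a3" "\<And>x y. norm (y - x) \<le> a3 \<Longrightarrow> norm (P y - P x) \<le> e"
    using unif[OF fwd.uc_P] by blast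
  obtain a4 where a4: "0 < a4" "\<And>x y. norm (y - x) \<le> a4 \<Longrightarrow> norm (Q y - Q x) \<le> e"
    using unif[OF bwd.uc_P] by blast
  define m where "m = Min {d1, d2, a1, a2, a3, a4}"
  have m: "0 < m" "m \<le> d1" "m \<le> d2" "m \<le> a1" "m \<le> a2" "m \<le> a3" "m \<le> a4"
    using d1(1) d2(1) a1(1) a2(1) a3(1) a4(1) unfolding m_def by auto
  \<comment> \<open>The division by \<open>R\<close> serves the inverses: \<open>fi\<close> is
    \<open>R\<close>-Lipschitz, so maps within \<open>m / R\<close> of each other have inverses
    within \<open>m\<close>.\<close>
  have "perturbed \<phi> \<phi>i N e"
    if inv: "\<And>x. \<phi> (\<phi>i x) = x" "\<And>x. \<phi>i (\<phi> x) = x" and u: "uc \<phi>" "uc \<phi>i"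
      and close: "\<And>x. norm (f x - \<phi> x) \<le> m / R" for \<phi> \<phi>i
  proof -
    have cl: "norm (f x - \<phi> x) \<le> m" for x
      using close[of x] R m(1) by (smt (verit) divide_le_eq_1_pos frac_le div_by_1)
    have cli: "norm (fi x - \<phi>i x) \<le> m" for x
    proof -
      have "norm (fi x - \<phi>i x) = norm (fi (f (\<phi>i x)) - fi (\<phi> (\<phi>i x)))"
        by (simp add: fi_f inv norm_minus_commute)
      also have "\<dots> \<le> R * (m / R)"
        by (rule order_trans[OF bwd.lip]) (use R in \<open>intro mult_left_mono close, auto\<close>)
      finally show ?thesis using R by simp
    qed
    have cl': "norm (\<phi> x - f x) \<le> m" "norm (\<phi>i x - fi x) \<le> m" for x
      using cl[of x] cli[of x] by (simp_all add: norm_minus_commute)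
    show ?thesis
      unfolding perturbed_def
      by (intro conjI allI inv u d1(2) d2(2) a1(2) a2(2) a3(2) a4(2)
          order_trans[OF cl m(2)] order_trans[OF cli m(3)] order_trans[OF cl'(2) m(4)]
          order_trans[OF cl m(5)] order_trans[OF cl'(1) m(6)] order_trans[OF cl'(1) m(7)])
  qed
  with m(1) R show ?thesis by (intro that[of "m / R"]) auto
qed

text \<open>Subtracting \<open>Q x (w x)\<close> removes the term of index 0 from the unstable sum.
  Starting at index 1 makes T reproduce the unstable part of \<open>w\<close>, and it also places
  each unstable term in a space Df^-1 E^u.\<close>

definition right_inverse ::
  "nat \<Rightarrow> ('a \<Rightarrow> 'a) \<Rightarrow> ('a \<Rightarrow> 'a) \<Rightarrow> ('a \<Rightarrow> 'a) \<Rightarrow> 'a \<Rightarrow> 'a" where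
  "right_inverse N \<phi> \<phi>i w x = fwd.orbit_sum N \<phi>i (\<lambda>x. P x (w x)) x
     - (bwd.orbit_sum N \<phi> (\<lambda>x. Q x (w x)) x - Q x (w x))"

lemma right_inverse_diff:
  "right_inverse N \<phi> \<phi>i w x - right_inverse N \<phi> \<phi>i v x = right_inverse N \<phi> \<phi>i (\<lambda>x. w x - v x) x"
  unfolding right_inverse_def blinfun.diff_right
    fwd.orbit_sum_diff[symmetric] bwd.orbit_sum_diff[symmetric] by simp

lemma uc_right_inverse:
  assumes "uc \<phi>" "uc \<phi>i" "uc w" "\<And>x. norm (w x) \<le> a"
  shows "uc (right_inverse N \<phi> \<phi>i w)"
proof -
  have "uc (\<lambda>x. P x (w x))" "uc (\<lambda>x. Q x (w x))"
    using uc_blinfun_apply[OF fwd.uc_P fwd.norm_P assms(3,4)]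
      uc_blinfun_apply[OF bwd.uc_P bwd.norm_P assms(3,4)] by auto
  then show ?thesis
    unfolding right_inverse_def[abs_def]
    by (intro uniformly_continuous_on_diff fwd.uc_orbit_sum[where a = "C * a"]
        bwd.uc_orbit_sum[where a = "C * a"] fwd.norm_P_apply bwd.norm_P_apply assms)
qed

lemma norm_right_inverse:
  assumes w: "\<And>x. norm (w x) \<le> a"
  shows "norm (right_inverse N \<phi> \<phi>i w x) \<le> (2 * (real N * R ^ N) + 1) * C * a"
proof -
  have "norm (right_inverse N \<phi> \<phi>i w x)
      \<le> real N * R ^ N * (C * a) + (real N * R ^ N * (C * a) + C * a)"
    unfolding right_inverse_def
    by (intro norm_triangle_le_diff add_mono fwd.orbit_sum_bound bwd.orbit_sum_bound
        fwd.norm_P_apply bwd.norm_P_apply w)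
  then show ?thesis by (simp add: algebra_simps)
qed

text \<open>The stable half is \<open>orbit_sum_approx\<close> at \<open>x\<close>; the unstable
  half is its time reversal at \<open>y = \<phi>i x\<close>, carried to \<open>x\<close> by
  \<open>A y\<close>. But \<open>Ai x\<close> is inverted by \<open>A (fi x)\<close> and not by
  \<open>A y\<close>: hence a third error, bounded by the closeness of these two operators.\<close>

lemma right_inverse_approx:
  assumes N: "0 < N" and pert: "perturbed \<phi> \<phi>i N e" and w: "\<And>x. norm (w x) \<le> a"
  shows "norm (w x - right_inverse N \<phi> \<phi>i w x + A (\<phi>i x) (right_inverse N \<phi> \<phi>i w (\<phi>i x)))
    \<le> ((C * lam ^ N + real N * R ^ N * e) * C * (1 + R) + e * (R * (real N * R ^ N * C))) * a"
proof -
  have inv: "\<And>x. \<phi> (\<phi>i x) = x" "\<And>x. \<phi>i (\<phi> x) = x"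
    and drift: "fwd.drift \<phi> N e" "bwd.drift \<phi>i N e"
    and close: "norm (A (\<phi>i x) - A (fi x)) \<le> e"
    using pert by (auto simp: perturbed_def)
  define p q where "p x = P x (w x)" and "q x = Q x (w x)" for x
  define S U where "S = fwd.orbit_sum N \<phi>i p" and "U = bwd.orbit_sum N \<phi> q"
  define y where "y = \<phi>i x"
  define \<beta> where "\<beta> = (C * lam ^ N + real N * R ^ N * e) * (C * a)"
  define e1 where "e1 = p x - S x + A y (S y)"
  define e2 where "e2 = q y - U y + Ai x (U x)"
  have p: "norm (p x) \<le> C * a" "p x \<in> range (P x)" and q: "norm (q x) \<le> C * a" "q x \<in> range (Q x)" for x
    by (auto simp: p_def q_def intro: fwd.norm_P_apply bwd.norm_P_apply w)
  have e1: "norm e1 \<le> \<beta>"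
    unfolding e1_def \<beta>_def S_def y_def by (rule fwd.orbit_sum_approx[OF N inv(1) drift(1) p])
  have e2: "norm e2 \<le> \<beta>"
    using bwd.orbit_sum_approx[OF N inv(2) drift(2) q, of y]
    unfolding e2_def \<beta>_def U_def y_def inv .
  have "A y (U y - q y) = A y (Ai x (U x) - e2)" by (simp add: e2_def)
  also have "\<dots> = U x + (A y - A (fi x)) (Ai x (U x)) - A y e2"
    by (simp add: blinfun.diff_right blinfun.diff_left A_Ai)
  finally have "A y (U y - q y) = U x + (A y - A (fi x)) (Ai x (U x)) - A y e2" .
  moreover have "right_inverse N \<phi> \<phi>i w = (\<lambda>x. S x - (U x - q x))"
    by (simp add: right_inverse_def[abs_def] S_def U_def p_def[abs_def] q_def[abs_def])
  moreover have "w x = p x + q x" by (simp add: p_def q_def PQ)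
  ultimately have "w x - right_inverse N \<phi> \<phi>i w x + A (\<phi>i x) (right_inverse N \<phi> \<phi>i w (\<phi>i x))
      = e1 + A y e2 - (A y - A (fi x)) (Ai x (U x))"
    unfolding y_def[symmetric] by (simp add: e1_def blinfun.diff_right[of _ "S y"])
  also have "norm \<dots> \<le> \<beta> + R * \<beta> + e * (R * (real N * R ^ N * (C * a)))"
    unfolding U_def
    by (intro norm_triangle_le_diff norm_triangle_le add_mono e1 norm_blinfun_le fwd.norm_A bwd.norm_A
        e2 bwd.orbit_sum_bound q close[folded y_def])
  finally show ?thesis by (simp add: \<beta>_def algebra_simps)
qed

text \<open>Each unstable term ends with a factor \<open>Ai\<close>, which \<open>A\<close> undoes,
  so it lies in the preimage of an unstable space. Since the terms land at points of
  \<open>f\<close>-orbits started on the orbit of \<open>\<phi>\<close>, and not necessarily at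
  \<open>x\<close>, one subspace \<open>F\<close> has to contain the spaces at all points.\<close>

lemma right_inverse_mem:
  assumes N: "0 < N" and inv: "\<And>x. \<phi> (\<phi>i x) = x" "\<And>x. \<phi>i (\<phi> x) = x"
    and F: "subspace F" "\<And>x. range (P x) \<subseteq> F" "\<And>x. A x -` range (Q (f x)) \<subseteq> F"
  shows "right_inverse N \<phi> \<phi>i w x \<in> F"
proof -
  define q where "q x = Q x (w x)" for x
  define T where "T n = cocycle fi Ai n ((\<phi> ^^ n) x) (q ((\<phi> ^^ n) x))" for n
  obtain m where m: "N = Suc m" using N by (cases N) auto
  have "fwd.orbit_sum N \<phi>i (\<lambda>x. P x (w x)) x \<in> F"
    unfolding fwd.orbit_sum_def
    by (intro subspace_sum F(1)) (rule subsetD[OF F(2)], rule fwd.cocycle_range, rule rangeI)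
  moreover have "bwd.orbit_sum N \<phi> q x - q x = (\<Sum>n<m. T (Suc n))"
    using sum.lessThan_Suc_shift[of T m] by (simp add: m bwd.orbit_sum_def T_def)
  moreover have "T (Suc n) \<in> F" for n
  proof -
    define z where "z = (\<phi> ^^ Suc n) x"
    define v where "v = cocycle fi Ai n z (q z)"
    have "v \<in> range (Q ((fi ^^ n) z))" unfolding v_def q_def by (intro bwd.cocycle_range rangeI)
    then have "A (fi ((fi ^^ n) z)) (Ai ((fi ^^ n) z) v) \<in> range (Q (f (fi ((fi ^^ n) z))))"
      by (simp add: A_Ai f_fi)
    then show ?thesis
      using F(3)[of "fi ((fi ^^ n) z)"] unfolding T_def z_def[symmetric] by (auto simp: v_def)
  qed
  ultimately show ?thesis
    unfolding right_inverse_def q_def[symmetric]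
    by (auto intro!: subspace_diff subspace_sum F(1))
qed

lemma Q_range_step:
  assumes "A x v \<in> range (Q (f x))"
  shows "v \<in> range (Q x)"
  using bwd.range_A[OF assms] by (simp add: Ai_A fi_f)

lemma P_eq_self: "v \<in> range (P x) \<Longrightarrow> P x v = v"
  using fwd.idem by auto

lemma Q_eq_self: "v \<in> range (Q x) \<Longrightarrow> Q x v = v"
  using bwd.idem by auto

lemma P_eq_0: "v \<in> range (Q x) \<Longrightarrow> P x v = 0"
  using PQ[of x v] Q_eq_self[of v x] by simp

lemma Q_eq_0: "v \<in> range (P x) \<Longrightarrow> Q x v = 0"
  using PQ[of x v] P_eq_self[of v x] by simp

text \<open>The second condition on \<open>k\<close> says that \<open>k x\<close> lies in E^s_x +
  Df(x)^-1 E^u_(f x). For such vectors \<open>A\<close> respects both components (\<open>PA\<close>,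
  \<open>QA\<close>), so \<open>s\<close> and \<open>u\<close> obey separate approximate equations,
  bounded by \<open>almost_invariant_bound\<close> forwards and backwards. Otherwise the image of
  \<open>u\<close> could leak into the stable component.\<close>

lemma left_bound:
  assumes N: "0 < N" and pert: "perturbed \<phi> \<phi>i N e"
    and k: "\<And>x. norm (k x) \<le> a" "\<And>x. A x (Q x (k x)) \<in> range (Q (f x))"
    and b: "\<And>x. norm (k x - A (\<phi>i x) (k (\<phi>i x))) \<le> b"
  shows "norm (k x) \<le> (2 * (C * C * lam ^ N) + e * (real N * R ^ N) * (R + R * R + 3 * C)) * a
            + real N * R ^ N * (1 + R) * C * b"
proof -
  have inv: "\<And>x. \<phi> (\<phi>i x) = x" "\<And>x. \<phi>i (\<phi> x) = x"
    and drift: "fwd.drift \<phi> N e" "bwd.drift \<phi>i N e"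
    and close: "\<And>x. norm (Ai (f x) - Ai (\<phi> x)) \<le> e"
       "\<And>x. norm (P (\<phi> x) - P (f x)) \<le> e" "\<And>x. norm (Q (\<phi> x) - Q (f x)) \<le> e"
    using pert by (auto simp: perturbed_def)
  define s u where "s x = P x (k x)" and "u x = Q x (k x)" for x
  define c where "c = C * b + e * (R * a)"
  have s: "norm (s x) \<le> C * a" "s x \<in> range (P x)" and u: "norm (u x) \<le> C * a" "u x \<in> range (Q x)" for x
    by (auto simp: s_def u_def intro: fwd.norm_P_apply bwd.norm_P_apply k)
  have ksu: "k x = s x + u x" for x by (simp add: s_def u_def PQ)
  have As: "A y (s y) \<in> range (P (f y))" for y by (intro fwd.range_A s)
  have Au: "A y (u y) \<in> range (Q (f y))" for y unfolding u_def by (rule k)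
  have PA: "P (f y) (A y (k y)) = A y (s y)" for y
    unfolding ksu[of y] blinfun.add_right P_eq_self[OF As] P_eq_0[OF Au] by simp
  have QA: "Q (f y) (A y (k y)) = A y (u y)" for y
    unfolding ksu[of y] blinfun.add_right Q_eq_0[OF As] Q_eq_self[OF Au] by simp
  have k': "norm (A y (k y)) \<le> R * a" for y by (intro norm_blinfun_le fwd.norm_A k)
  have b': "norm (k (\<phi> y) - A y (k y)) \<le> b" for y using b[of "\<phi> y"] by (simp add: inv)
  have sstep: "norm (s (\<phi> y) - A y (s y)) \<le> c" for y
  proof -
    \<comment> \<open>\<open>A y (k y)\<close> splits according to the projections at
      \<open>f y\<close>, while \<open>s\<close> uses those at \<open>\<phi> y\<close>; the uniform
      continuity of the projections pays for the change of base point.\<close>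
    have "s (\<phi> y) - A y (s y) = P (\<phi> y) (k (\<phi> y) - A y (k y)) + (P (\<phi> y) - P (f y)) (A y (k y))"
      by (simp add: blinfun.diff_left blinfun.diff_right PA) (simp add: s_def)
    also have "norm \<dots> \<le> c"
      unfolding c_def
      by (intro norm_triangle_le add_mono fwd.norm_P_apply b' norm_blinfun_le[OF close(2)] k')
    finally show ?thesis .
  qed
  have ustep: "norm (u (\<phi> y) - A y (u y)) \<le> c" for y
  proof -
    have "u (\<phi> y) - A y (u y) = Q (\<phi> y) (k (\<phi> y) - A y (k y)) + (Q (\<phi> y) - Q (f y)) (A y (k y))"
      by (simp add: blinfun.diff_left blinfun.diff_right QA) (simp add: u_def)
    also have "norm \<dots> \<le> c"
      unfolding c_def
      by (intro norm_triangle_le add_mono bwd.norm_P_apply b' norm_blinfun_le[OF close(3)] k')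
    finally show ?thesis .
  qed
  have ustep': "norm (u y - Ai (\<phi> y) (u (\<phi> y))) \<le> R * c + e * (C * a)" for y
  proof -
    \<comment> \<open>The forward defect becomes a backward one through \<open>Ai (f y)\<close>,
      which undoes \<open>A y\<close>; replacing \<open>Ai (\<phi> y)\<close> by
      \<open>Ai (f y)\<close> costs the first summand.\<close>
    have "u y - Ai (\<phi> y) (u (\<phi> y))
        = (Ai (f y) - Ai (\<phi> y)) (u (\<phi> y)) - Ai (f y) (u (\<phi> y) - A y (u y))"
      by (simp add: blinfun.diff_left blinfun.diff_right Ai_A)
    also have "norm \<dots> \<le> e * (C * a) + R * c"
      by (intro norm_triangle_le_diff add_mono norm_blinfun_le close bwd.norm_A ustep u)
    finally show ?thesis by simp
  qed
  have "norm (s x) \<le> C * lam ^ N * (C * a) + real N * R ^ N * (c + e * (C * a))"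
    by (rule fwd.almost_invariant_bound[OF N inv(1) drift(1) s])
       (use sstep[of "\<phi>i _"] in \<open>simp add: inv\<close>)
  moreover have "norm (u x) \<le> C * lam ^ N * (C * a) + real N * R ^ N * ((R * c + e * (C * a)) + e * (C * a))"
    by (rule bwd.almost_invariant_bound[OF N inv(2) drift(2) u ustep'])
  ultimately have "norm (k x) \<le> (C * lam ^ N * (C * a) + real N * R ^ N * (c + e * (C * a)))
      + (C * lam ^ N * (C * a) + real N * R ^ N * ((R * c + e * (C * a)) + e * (C * a)))"
    unfolding ksu[of x] by (intro norm_triangle_le add_mono)
  then show ?thesis by (simp add: c_def algebra_simps)
qed

text \<open>The order of choice matters: \<open>N\<close> makes the terms with
  \<open>lam ^ N\<close> at most 1/4, then \<open>e\<close> is taken small against the possibly huge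
  \<open>R ^ N\<close>. Since \<open>1 \<le> R\<close>, the single quantity
  \<open>2 * R * C * C * lam ^ N\<close> dominates the contraction terms of both
  inequalities.\<close>

lemma iterate_and_tolerance:
  obtains N e where "0 < N" "0 < e"
    "(C * lam ^ N + real N * R ^ N * e) * C * (1 + R) + e * (R * (real N * R ^ N * C)) \<le> 1 / 2"
    "2 * (C * C * lam ^ N) + e * (real N * R ^ N) * (R + R * R + 3 * C) \<le> 1 / 2"
proof -
  note cb = fwd.const_bounds
  have "(\<lambda>n. 2 * R * C * C * lam ^ n) \<longlonglongrightarrow> 2 * R * C * C * 0"
    by (intro tendsto_mult_left LIMSEQ_realpow_zero) (use cb in auto)
  then have "\<forall>\<^sub>F n in sequentially. 2 * R * C * C * lam ^ n < 1 / 4"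
    by (rule order_tendstoD) simp
  then have "\<forall>\<^sub>F n in sequentially. 0 < n \<and> 2 * R * C * C * lam ^ n < 1 / 4"
    using eventually_conj[OF eventually_gt_at_top[of 0]] by blast
  then obtain N where N: "0 < N" "2 * R * C * C * lam ^ N < 1 / 4"
    using eventually_happens trivial_limit_sequentially by blast
  define M where "M = real N * R ^ N"
  \<comment> \<open>The sum of the coefficients of \<open>e\<close> in the two inequalities, so that
    \<open>e * X = 1 / 4\<close> settles both.\<close>
  define X where "X = M * C * (1 + R) + R * (M * C) + M * (R + R * R + 3 * C)"
  have M: "0 < M" using N cb by (simp add: M_def)
  have X: "0 < X" unfolding X_def using M cb by (intro add_pos_pos mult_pos_pos) auto
  define e where "e = 1 / (4 * X)"
  have e: "0 < e" "e * X = 1 / 4" using X by (simp_all add: e_def)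
  have l: "0 \<le> C * C * lam ^ N" using cb by simp
  have "C * C * lam ^ N * (1 + R) \<le> C * C * lam ^ N * (2 * R)"
    using cb by (intro mult_left_mono l) auto
  moreover have "C * C * lam ^ N * 1 \<le> C * C * lam ^ N * R"
    using cb by (intro mult_left_mono l) auto
  moreover have "0 \<le> e * (M * (R + R * R + 3 * C))" "0 \<le> e * (M * C * (1 + R) + R * (M * C))"
    using e M cb by auto
  moreover have "e * X = e * (M * C * (1 + R) + R * (M * C)) + e * (M * (R + R * R + 3 * C))"
    by (simp add: X_def algebra_simps)
  ultimately have "(C * lam ^ N + M * e) * C * (1 + R) + e * (R * (M * C)) \<le> 1 / 2"
    "2 * (C * C * lam ^ N) + e * M * (R + R * R + 3 * C) \<le> 1 / 2"
    using N(2) e(2) by (auto simp: algebra_simps)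
  then show ?thesis using that[OF N(1) e(1)] by (simp add: M_def)
qed

end

section \<open>The nonlinear conjugacy equation: existence and uniqueness\<close>

context hyperbolic_splitting
begin

text \<open>\<open>K\<close> bounds the norm of the right inverse, and on the ball of radius
  \<open>\<rho>\<close> the target \<open>\<psi>\<close> differs from its linear model by a map with
  Lipschitz constant \<open>1 / (4 * K)\<close>. After composition with the right inverse this
  remainder contributes 1/4, next to the 1/2 from \<open>size\<close>.\<close>

lemma semiconjugacy_exists:
  assumes N: "0 < N"
    and size: "(C * lam ^ N + real N * R ^ N * e) * C * (1 + R) + e * (R * (real N * R ^ N * C)) \<le> 1 / 2"
    and pert: "perturbed \<phi> \<phi>i N e"
    and K: "0 < K" "(2 * (real N * R ^ N) + 1) * C \<le> K"
    and uc_\<psi>: "uc \<psi>"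
    and lin: "\<And>y u v. norm u \<le> \<rho> \<Longrightarrow> norm v \<le> \<rho> \<Longrightarrow>
        norm (\<psi> (y + u) - \<psi> (y + v) - A y (u - v)) \<le> 1 / (4 * K) * norm (u - v)"
    and d: "\<And>x. norm (\<psi> x - \<phi> x) \<le> d" "4 * K * d \<le> \<rho>"
  obtains h where "uc h" "\<And>x. norm (h x) \<le> 4 * K * d" "\<And>x. \<psi> (x + h x) = \<phi> x + h (\<phi> x)"
    "\<And>F x. subspace F \<Longrightarrow> (\<And>x. range (P x) \<subseteq> F) \<Longrightarrow> (\<And>x. A x -` range (Q (f x)) \<subseteq> F) \<Longrightarrow> h x \<in> F"
proof -
  have inv: "\<And>x. \<phi> (\<phi>i x) = x" "\<And>x. \<phi>i (\<phi> x) = x" and u: "uc \<phi>" "uc \<phi>i"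
    using pert by (auto simp: perturbed_def)
  have d0: "0 \<le> d" using d(1) norm_ge_zero order_trans by blast
  define L where "L = right_inverse N \<phi> \<phi>i"
  \<comment> \<open>\<open>F w = w\<close> cancels \<open>w\<close> and leaves
    \<open>L w x = \<psi> (\<phi>i x + L w (\<phi>i x)) - x\<close>, the conjugacy equation for
    \<open>h = L w\<close> at the point \<open>\<phi>i x\<close>.\<close>
  define F where "F w x = w x - L w x + (\<psi> (\<phi>i x + L w (\<phi>i x)) - x)" for w x
  have L: "norm (L w x) \<le> K * a" if "\<And>x. norm (w x) \<le> a" for w a x
  proof -
    have "0 \<le> a" using that norm_ge_zero order_trans by blast
    then show ?thesis
      using norm_right_inverse[of w a N \<phi> \<phi>i x, OF that] mult_right_mono[OF K(2)] unfolding L_def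
      by (meson order_trans)
  qed
  have L\<rho>: "norm (L w x) \<le> \<rho>" if "\<And>x. norm (w x) \<le> 4 * d" for w x
    using L[of w "4 * d", OF that, of x] d(2) by (simp add: algebra_simps)
  have contr: "norm (F w x - F v x) \<le> 3 / 4 * a"
    if wv: "\<And>x. norm (w x) \<le> 4 * d" "\<And>x. norm (v x) \<le> 4 * d" "\<And>x. norm (w x - v x) \<le> a" for w v a x
  proof -
    define y where "y = \<phi>i x"
    define t where "t x = w x - v x" for x
    have a: "0 \<le> a" using wv(3) norm_ge_zero order_trans by blast
    have t: "norm (t x) \<le> a" for x using wv(3) by (simp add: t_def)
    have Ld: "L w x - L v x = L t x" for x by (simp add: L_def right_inverse_diff t_def[abs_def])
    have "F w x - F v x = (t x - L t x + A y (L t y))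
        + (\<psi> (y + L w y) - \<psi> (y + L v y) - A y (L w y - L v y))"
      unfolding F_def y_def[symmetric] by (simp add: Ld[symmetric] t_def)
    also have "norm \<dots> \<le> 1 / 2 * a + 1 / (4 * K) * (K * a)"
    proof (rule order_trans[OF norm_triangle_ineq add_mono])
      have "norm (t x - L t x + A y (L t y))
          \<le> ((C * lam ^ N + real N * R ^ N * e) * C * (1 + R) + e * (R * (real N * R ^ N * C))) * a"
        unfolding L_def y_def by (rule right_inverse_approx[OF N pert t])
      also have "\<dots> \<le> 1 / 2 * a" by (intro mult_right_mono size a)
      finally show "norm (t x - L t x + A y (L t y)) \<le> 1 / 2 * a" .
      have "norm (\<psi> (y + L w y) - \<psi> (y + L v y) - A y (L w y - L v y))
          \<le> 1 / (4 * K) * norm (L w y - L v y)"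
        by (intro lin L\<rho> wv)
      also have "\<dots> \<le> 1 / (4 * K) * (K * a)"
        unfolding Ld using K(1) by (intro mult_left_mono L t) auto
      finally show "norm (\<psi> (y + L w y) - \<psi> (y + L v y) - A y (L w y - L v y))
          \<le> 1 / (4 * K) * (K * a)" .
    qed
    finally show ?thesis using K(1) by simp
  qed
  have F0: "norm (F (\<lambda>_. 0) x) \<le> d" for x
  proof -
    have "L (\<lambda>_. 0) x = 0" for x using L[of "\<lambda>_. 0" 0] by simp
    then show ?thesis using d(1)[of "\<phi>i x"] by (simp add: F_def inv)
  qed
  have self: "uc (F w) \<and> (\<forall>x. norm (F w x) \<le> 4 * d)" if w: "uc w" "\<And>x. norm (w x) \<le> 4 * d" for w
  proof (intro conjI allI)
    have "uc (L w)" unfolding L_def by (rule uc_right_inverse[OF u w])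
    then have "uc (\<lambda>x. \<phi>i x + L w (\<phi>i x))"
      by (intro uniformly_continuous_on_add u uc_compose[OF u(2)])
    then have "uc (\<lambda>x. \<psi> (\<phi>i x + L w (\<phi>i x)))" by (rule uc_compose[OF _ uc_\<psi>])
    then show "uc (F w)"
      unfolding F_def[abs_def]
      by (intro uniformly_continuous_on_add uniformly_continuous_on_diff w \<open>uc (L w)\<close>
          uniformly_continuous_on_id)
  next
    fix x
    \<comment> \<open>The radius \<open>4 * d\<close> is the one reproduced by the estimate:
      \<open>d\<close> from \<open>F0\<close> plus 3/4 of \<open>4 * d\<close>.\<close>
    have "norm (F w x - F (\<lambda>_. 0) x) \<le> 3 / 4 * (4 * d)"
      by (rule contr) (use w d0 in auto)
    then show "norm (F w x) \<le> 4 * d"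
      using F0[of x] norm_triangle_sub[of "F w x" "F (\<lambda>_. 0) x"] by simp
  qed
  obtain w where w: "uc w" "\<And>x. norm (w x) \<le> 4 * d" "F w = w"
    by (rule bounded_uc_fixed_point[of "4 * d" "3 / 4" F]) (use d0 self contr in auto)
  show ?thesis
  proof (rule that)
    show "uc (L w)" unfolding L_def by (rule uc_right_inverse[OF u w(1,2)])
    show "norm (L w x) \<le> 4 * K * d" for x using L[of w "4 * d", OF w(2)] by (simp add: algebra_simps)
    show "\<psi> (x + L w x) = \<phi> x + L w (\<phi> x)" for x
      using fun_cong[OF w(3), of "\<phi> x"] by (simp add: F_def inv algebra_simps)
    show "L w x \<in> F" if "subspace F" "\<And>x. range (P x) \<subseteq> F" "\<And>x. A x -` range (Q (f x)) \<subseteq> F" for F x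
      unfolding L_def by (rule right_inverse_mem[OF N inv that])
  qed
qed

text \<open>By \<open>lin\<close> with \<open>v = 0\<close>, exact commutation makes
  \<open>k\<close> almost invariant with defect \<open>a / (4 * K)\<close> whenever \<open>k\<close>
  is bounded by \<open>a\<close>. Then \<open>left_bound\<close> improves the bound \<open>a\<close>
  to \<open>3 / 4 * a\<close>, and iteration from \<open>\<rho>\<close> leaves only 0.\<close>

lemma centralizer_trivial:
  assumes N: "0 < N"
    and size: "2 * (C * C * lam ^ N) + e * (real N * R ^ N) * (R + R * R + 3 * C) \<le> 1 / 2"
    and pert: "perturbed \<phi> \<phi>i N e"
    and K: "0 < K" "real N * R ^ N * (1 + R) * C \<le> K"
    and lin: "\<And>y u v. norm u \<le> \<rho> \<Longrightarrow> norm v \<le> \<rho> \<Longrightarrow>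
        norm (\<phi> (y + u) - \<phi> (y + v) - A y (u - v)) \<le> 1 / (4 * K) * norm (u - v)"
    and k: "\<And>x. norm (k x) \<le> \<rho>" "\<And>x. A x (Q x (k x)) \<in> range (Q (f x))"
      "\<And>x. \<phi> (x + k x) = \<phi> x + k (\<phi> x)"
  shows "k x = 0"
proof -
  have inv: "\<And>x. \<phi> (\<phi>i x) = x" using pert by (auto simp: perturbed_def)
  have \<rho>: "0 \<le> \<rho>" using k(1) norm_ge_zero order_trans by blast
  have step: "norm (k x) \<le> 3 / 4 * a" if a: "\<And>x. norm (k x) \<le> a" for a x
  proof -
    have a0: "0 \<le> a" using a norm_ge_zero order_trans by blast
    have b: "norm (k x - A (\<phi>i x) (k (\<phi>i x))) \<le> 1 / (4 * K) * a" for x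
    proof -
      have "norm (k x - A (\<phi>i x) (k (\<phi>i x))) \<le> 1 / (4 * K) * norm (k (\<phi>i x))"
        using lin[of "k (\<phi>i x)" 0 "\<phi>i x", OF k(1)] \<rho> k(3)[of "\<phi>i x"] by (simp add: inv)
      also have "\<dots> \<le> 1 / (4 * K) * a" using K(1) by (intro mult_left_mono a) auto
      finally show ?thesis .
    qed
    have "norm (k x) \<le> (2 * (C * C * lam ^ N) + e * (real N * R ^ N) * (R + R * R + 3 * C)) * a
            + real N * R ^ N * (1 + R) * C * (1 / (4 * K) * a)"
      by (rule left_bound[OF N pert a k(2) b])
    also have "\<dots> \<le> 1 / 2 * a + K * (1 / (4 * K) * a)"
      using a0 K(1) by (intro add_mono mult_right_mono size K(2)) auto
    also have "\<dots> = 3 / 4 * a" using K(1) by simp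
    finally show ?thesis .
  qed
  have "norm (k x) \<le> (3 / 4) ^ n * \<rho>" for n x
  proof (induction n arbitrary: x)
    case 0
    then show ?case using k(1) by simp
  next
    case (Suc n)
    show ?case using step[OF Suc, of x] by (simp add: mult.assoc)
  qed
  moreover have "(\<lambda>n. (3 / 4) ^ n * \<rho>) \<longlonglongrightarrow> 0 * \<rho>"
    by (intro tendsto_mult_right LIMSEQ_realpow_zero) auto
  ultimately have "norm (k x) \<le> 0 * \<rho>"
    by (intro LIMSEQ_le_const[where X = "\<lambda>n. (3 / 4) ^ n * \<rho>"]) auto
  then show ?thesis by simp
qed

end

section \<open>Derivative estimates for the diffeomorphism class\<close>

lemma blinfun_diff_bound:
  fixes \<psi> :: "'a::banach \<Rightarrow> 'a"
  assumes diff: "\<And>x. \<psi> differentiable (at x)"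
    and B: "\<And>z. norm z \<le> \<rho> \<Longrightarrow> norm (fderiv \<psi> (y + z) - B) \<le> \<eta>"
    and uv: "norm u \<le> \<rho>" "norm v \<le> \<rho>"
  shows "norm (\<psi> (y + u) - \<psi> (y + v) - blinfun_apply B (u - v)) \<le> \<eta> * norm (u - v)"
proof -
  define F where "F z = \<psi> (y + z) - blinfun_apply B z" for z
  have "norm (F u - F v) \<le> \<eta> * norm (u - v)"
  proof (rule differentiable_bound)
    show "convex (cball (0::'a) \<rho>)" by simp
    show "u \<in> cball 0 \<rho>" "v \<in> cball 0 \<rho>" using uv by simp_all
    fix z :: 'a assume z: "z \<in> cball 0 \<rho>"
    have "((\<lambda>z. \<psi> (y + z)) has_derivative (\<lambda>w. fderiv \<psi> (y + z) w)) (at z)"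
      using has_derivative_compose[of "\<lambda>z. y + z" "\<lambda>w. w" z UNIV \<psi> "fderiv \<psi> (y + z)"]
        fderiv_works[OF diff[of "y + z"]] by (simp add: has_derivative_add_const add.commute)
    then have "(F has_derivative (\<lambda>w. fderiv \<psi> (y + z) w - B w)) (at z)"
      unfolding F_def[abs_def]
      by (intro has_derivative_diff bounded_linear_imp_has_derivative blinfun.bounded_linear_right)
    then show "(F has_derivative blinfun_apply (fderiv \<psi> (y + z) - B)) (at z within cball 0 \<rho>)"
      by (simp add: has_derivative_at_withinI blinfun.diff_left[abs_def] minus_blinfun.rep_eq)
    show "onorm (blinfun_apply (fderiv \<psi> (y + z) - B)) \<le> \<eta>"
      using B[of z] z by (simp add: norm_blinfun.rep_eq)
  qed
  then show ?thesis by (simp add: F_def blinfun.diff_right algebra_simps)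
qed

lemma lipschitz_fderiv:
  fixes \<psi> :: "'a::banach \<Rightarrow> 'a"
  assumes "\<And>x. \<psi> differentiable (at x)" "\<And>x. norm (fderiv \<psi> x) \<le> R"
  shows "norm (\<psi> x - \<psi> y) \<le> R * norm (x - y)"
proof (rule differentiable_bound[OF convex_UNIV])
  show "(\<psi> has_derivative fderiv \<psi> x) (at x)" for x by (intro fderiv_works assms)
  show "onorm (blinfun_apply (fderiv \<psi> x)) \<le> R" for x
    using assms(2) by (simp add: norm_blinfun.rep_eq)
qed auto

lemma fderiv_inverse:
  assumes "\<And>x. f differentiable (at x)" "\<And>x. g differentiable (at x)" "\<And>x. f (g x) = x"
  shows "blinfun_apply (fderiv f (g x)) (blinfun_apply (fderiv g x) v) = v"
proof -
  have "(f \<circ> g has_derivative fderiv f (g x) \<circ> fderiv g x) (at x)"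
    by (intro diff_chain_at fderiv_works assms)
  moreover have "f \<circ> g = (\<lambda>x. x)" using assms(3) by auto
  ultimately have "(\<lambda>v. v) = blinfun_apply (fderiv f (g x)) \<circ> blinfun_apply (fderiv g x)"
    using has_derivative_unique[OF has_derivative_ident] by metis
  then show ?thesis by (metis comp_apply)
qed

lemma diffeo_classE:
  assumes f: "f \<in> diffeo_class"
  obtains R where "1 \<le> R" "bij f" "\<And>x. f differentiable (at x)" "\<And>x. inv f differentiable (at x)"
    "\<And>x. norm (fderiv f x) \<le> R" "\<And>x. norm (fderiv (inv f) x) \<le> R" "uc (fderiv f)"
proof -
  obtain R r where R: "R > 0" and r: "(r \<longlongrightarrow> 0) (at_right 0)"
    and bounds: "\<And>x v. v \<noteq> 0 \<Longrightarrow> norm (fderiv f x) \<le> R \<and> norm (fderiv (inv f) x) \<le> R \<and>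
           norm (fderiv f (x + v) - fderiv f x) \<le> r (norm v)"
    and C1: "bij f" "\<And>x. f differentiable (at x)" "\<And>x. inv f differentiable (at x)"
    using f unfolding diffeo_class_def C1_diffeo_def C1_map_def by blast
  \<comment> \<open>The bounds of the class are guarded by \<open>v \<noteq> 0\<close> and say
    nothing in the zero space, where however every operator is 0. The maximum with 1 provides
    \<open>1 \<le> R\<close>.\<close>
  have R': "norm (fderiv f x) \<le> max 1 R \<and> norm (fderiv (inv f) x) \<le> max 1 R" for x
  proof (cases "\<exists>v::'a. v \<noteq> 0")
    case True
    then obtain v :: 'a where "v \<noteq> 0" by blast
    then show ?thesis using bounds[of v x] by auto
  next
    case False
    then have "B = 0" for B :: "'a \<Rightarrow>\<^sub>L 'a" by (intro blinfun_eqI) metis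
    then have "fderiv f x = 0" "fderiv (inv f) x = 0" by blast+
    then show ?thesis by simp
  qed
  have "uc (fderiv f)"
    unfolding uniformly_continuous_on_def
  proof (intro allI impI)
    fix \<epsilon> :: real assume "\<epsilon> > 0"
    with r have "\<forall>\<^sub>F z in at_right 0. r z < \<epsilon>" by (rule order_tendstoD)
    then obtain \<delta> where \<delta>: "\<delta> > 0" "\<And>z. 0 < z \<Longrightarrow> z < \<delta> \<Longrightarrow> r z < \<epsilon>"
      unfolding eventually_at_right_field by auto
    show "\<exists>\<delta>>0. \<forall>x\<in>UNIV. \<forall>y\<in>UNIV. dist y x < \<delta> \<longrightarrow> dist (fderiv f y) (fderiv f x) < \<epsilon>"
    proof (intro exI conjI ballI impI)
      fix x y :: 'a assume xy: "dist y x < \<delta>"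
      show "dist (fderiv f y) (fderiv f x) < \<epsilon>"
      proof (cases "y = x")
        case False
        then have "r (norm (y - x)) < \<epsilon>" using xy by (intro \<delta>) (auto simp: dist_norm)
        then show ?thesis using bounds[of "y - x" x] False by (simp add: dist_norm)
      qed (use \<open>\<epsilon> > 0\<close> in simp)
    qed (fact \<delta>(1))
  qed
  then show ?thesis using that[of "max 1 R"] C1 R' by auto
qed

text \<open>The class provides a modulus of continuity for the derivative of \<open>f\<close> only.
  It passes to the inverse by the resolvent identity B_y - B_x = B_y (A_x - A_y) B_x, where B is the
  derivative of the inverse and A that of \<open>f\<close> at the preimage.\<close>

lemma uc_fderiv_inv:
  fixes f :: "'a::banach \<Rightarrow> 'a"
  assumes bij: "bij f" and diff: "\<And>x. f differentiable (at x)" "\<And>x. inv f differentiable (at x)"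
    and R: "\<And>x. norm (fderiv (inv f) x) \<le> R" and uc: "uc (fderiv f)"
  shows "uc (fderiv (inv f))"
  unfolding uniformly_continuous_on_def
proof (intro allI impI)
  fix \<epsilon> :: real assume \<epsilon>: "\<epsilon> > 0"
  let ?A = "\<lambda>x. fderiv f (inv f x)" and ?B = "fderiv (inv f)"
  have R0: "0 \<le> R" using R norm_ge_zero order_trans by blast
  have inv: "inv f (f x) = x" "f (inv f x) = x" for x using bij by (simp_all add: bij_is_inj bij_is_surj surj_f_inv_f)
  have AB: "?A x (?B x v) = v" "?B x (?A x v) = v" for x v
    using fderiv_inverse[OF diff inv(2)] fderiv_inverse[OF diff(2,1) inv(1), of "inv f x"]
    by (auto simp: inv)
  have "uc ?A"
    by (rule uc_compose[OF uc_lipschitz uc]) (rule lipschitz_fderiv[OF diff(2) R])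
  moreover have "0 < \<epsilon> / (R * R + 1)" using \<epsilon> by (intro divide_pos_pos add_nonneg_pos) auto
  ultimately obtain \<delta> where \<delta>: "\<delta> > 0" "\<And>x y. dist y x < \<delta> \<Longrightarrow> dist (?A y) (?A x) < \<epsilon> / (R * R + 1)"
    unfolding uniformly_continuous_on_def by (metis UNIV_I)
  show "\<exists>\<delta>>0. \<forall>x\<in>UNIV. \<forall>y\<in>UNIV. dist y x < \<delta> \<longrightarrow> dist (?B y) (?B x) < \<epsilon>"
  proof (intro exI conjI ballI impI)
    fix x y :: 'a assume "dist y x < \<delta>"
    then have A: "norm (?A x - ?A y) \<le> \<epsilon> / (R * R + 1)"
      using \<delta>(2)[of y x] by (simp add: dist_norm norm_minus_commute)
    have "?B y - ?B x = ?B y o\<^sub>L ((?A x - ?A y) o\<^sub>L ?B x)"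
      by (rule blinfun_eqI) (simp add: blinfun.diff_left blinfun.diff_right AB)
    also have "norm \<dots> \<le> R * (\<epsilon> / (R * R + 1) * R)"
      by (intro norm_blinfun_compose_le' R A)
    also have "\<dots> = \<epsilon> * (R * R / (R * R + 1))" by simp
    also have "\<dots> < \<epsilon> * 1"
      using \<epsilon> by (intro mult_strict_left_mono) (auto simp: divide_less_eq add_nonneg_pos)
    finally show "dist (?B y) (?B x) < \<epsilon>" by (simp add: dist_norm)
  qed (fact \<delta>(1))
qed

lemma sup_norm_le: "norm (h x) \<le> c" if "sup_norm h \<le> ereal c"
proof -
  have "ereal (norm (h x)) \<le> sup_norm h" unfolding sup_norm_def by (rule SUP_upper) simp
  then show ?thesis using that by (metis ereal_less_eq(3) order_trans)
qed

lemma sup_norm_nonneg: "0 \<le> sup_norm h"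
  unfolding sup_norm_def by (rule SUP_upper2[where i = undefined]) auto

lemma C1_dist_less:
  assumes "C1_dist f g < ereal d"
  shows "norm (f x - g x) \<le> d" "norm (fderiv f x - fderiv g x) \<le> d"
proof -
  have "sup_norm (\<lambda>x. f x - g x) \<le> ereal d" "sup_norm (\<lambda>x. fderiv f x - fderiv g x) \<le> ereal d"
    using assms sup_norm_nonneg[of "\<lambda>x. f x - g x"] sup_norm_nonneg[of "\<lambda>x. fderiv f x - fderiv g x"]
    unfolding C1_dist_def
    by (metis add_increasing2 add_increasing order.refl le_less_trans less_imp_le)+
  then show "norm (f x - g x) \<le> d" "norm (fderiv f x - fderiv g x) \<le> d"
    using sup_norm_le[of "\<lambda>x. f x - g x"] sup_norm_le[of "\<lambda>x. fderiv f x - fderiv g x"] by auto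
qed

lemma hyperbolic_splitting_fderiv:
  fixes f :: "'a::banach \<Rightarrow> 'a"
  assumes f: "f \<in> diffeo_class" and hyp: "uc_gen_hyperbolic f P Q"
  obtains C lam R where
    "hyperbolic_splitting f (inv f) (fderiv f) (fderiv (inv f)) P Q C lam R"
proof -
  obtain R where R: "1 \<le> R" and bij: "bij f"
    and diff: "\<And>x. f differentiable (at x)" "\<And>x. inv f differentiable (at x)"
    and norms: "\<And>x. norm (fderiv f x) \<le> R" "\<And>x. norm (fderiv (inv f) x) \<le> R"
    and ucA: "uc (fderiv f)"
    using diffeo_classE[OF f] by metis
  obtain C lam where gh: "gen_hyperbolic f C lam P Q" and ucPQ: "uc P" "uc Q"
    using hyp unfolding uc_gen_hyperbolic_def by blast
  have C: "C > 0" "0 < lam" "lam < 1" using gh by (auto simp: gen_hyperbolic_def)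
  have PQ: "P x o\<^sub>L P x = P x" "Q x o\<^sub>L Q x = Q x" "P x + Q x = id_blinfun"
    "norm (P x) \<le> C" "norm (Q x) \<le> C"
    "fderiv f x ` range (P x) \<subseteq> range (P (f x))"
    "fderiv (inv f) x ` range (Q x) \<subseteq> range (Q (inv f x))" for x
    using gh by (auto simp: gen_hyperbolic_def)
  have contr: "norm (fderiv (f ^^ n) x v) \<le> C * lam ^ n * norm v" if "0 < n" "v \<in> range (P x)" for n x v
    using gh that unfolding gen_hyperbolic_def by blast
  have contr': "norm (fderiv (inv f ^^ n) x v) \<le> C * lam ^ n * norm v" if "0 < n" "v \<in> range (Q x)" for n x v
    using gh that unfolding gen_hyperbolic_def by blast
  have inv: "inv f (f x) = x" "f (inv f x) = x" for x
    using bij by (simp_all add: bij_is_inj bij_is_surj surj_f_inv_f)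
  have "hyperbolic_splitting f (inv f) (fderiv f) (fderiv (inv f)) P Q C lam R"
  proof unfold_locales
    show "norm (f x - f y) \<le> R * norm (x - y)" for x y by (rule lipschitz_fderiv[OF diff(1) norms(1)])
    show "norm (inv f x - inv f y) \<le> R * norm (x - y)" for x y by (rule lipschitz_fderiv[OF diff(2) norms(2)])
    show "uc (fderiv (inv f))" by (rule uc_fderiv_inv[OF bij diff norms(2) ucA])
    show "P x (P x v) = P x v" "Q x (Q x v) = Q x v" "P x v + Q x v = v" for x v
      using PQ(1,2,3)[of x] by (metis blinfun_apply_blinfun_compose plus_blinfun.rep_eq id_blinfun.rep_eq)+
    show "fderiv f x v \<in> range (P (f x))" if "v \<in> range (P x)" for x v using PQ(6) that by blast
    show "fderiv (inv f) x v \<in> range (Q (inv f x))" if "v \<in> range (Q x)" for x v using PQ(7) that by blast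
    show "norm (cocycle f (fderiv f) n x v) \<le> C * lam ^ n * norm v" if "0 < n" "v \<in> range (P x)" for n x v
      using contr[OF that] by (simp add: fderiv_funpow diff)
    show "norm (cocycle (inv f) (fderiv (inv f)) n x v) \<le> C * lam ^ n * norm v"
      if "0 < n" "v \<in> range (Q x)" for n x v
      using contr'[OF that] by (simp add: fderiv_funpow diff)
    show "fderiv f (inv f x) (fderiv (inv f) x v) = v" for x v
      by (rule fderiv_inverse[OF diff inv(2)])
    show "fderiv (inv f) (f x) (fderiv f x v) = v" for x v
      by (rule fderiv_inverse[OF diff(2,1) inv(1)])
  qed (fact R C norms ucA ucPQ inv PQ)+
  then show ?thesis by (rule that)
qed

lemma subspace_stable_unstable_sum: "subspace (stable_unstable_sum f P Q x)"
proof -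
  have "subspace (range (P x))" "subspace (fderiv f x -` range (Q (f x)))"
    by (intro linear_subspace_vimage linear_subspace_image subspace_UNIV
        bounded_linear.linear blinfun.bounded_linear_right)+
  from subspace_sums[OF this] show ?thesis
    unfolding stable_unstable_sum_def set_plus_def by (auto elim!: back_subst[of subspace])
qed

section \<open>The pair of semiconjugacies for a nearby diffeomorphism\<close>

lemma semiconjugacies_exist:
  fixes f :: "'a::banach \<Rightarrow> 'a"
  assumes f: "f \<in> diffeo_class" and hyp: "uc_gen_hyperbolic f P Q"
  obtains M d0 where "0 < M" "0 < d0"
    "\<And>d g. 0 < d \<Longrightarrow> d < d0 \<Longrightarrow> g \<in> diffeo_class \<Longrightarrow> C1_dist f g < ereal d \<Longrightarrow>
      \<exists>h1 h2. semiconj_pair f g (M * d) h1 h2 \<and>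
        ((\<forall>x y. stable_unstable_sum f P Q x = stable_unstable_sum f P Q y) \<longrightarrow>
          Id_plus h1 \<circ> Id_plus h2 = id \<and> Id_plus h2 \<circ> Id_plus h1 = id)"
proof -
  obtain C lam R where "hyperbolic_splitting f (inv f) (fderiv f) (fderiv (inv f)) P Q C lam R"
    using hyperbolic_splitting_fderiv[OF assms] .
  then interpret hyperbolic_splitting f "inv f" "fderiv f" "fderiv (inv f)" P Q C lam R .
  obtain N e where N: "0 < N" and e: "0 < e"
    and size1: "(C * lam ^ N + real N * R ^ N * e) * C * (1 + R) + e * (R * (real N * R ^ N * C)) \<le> 1 / 2"
    and size2: "2 * (C * C * lam ^ N) + e * (real N * R ^ N) * (R + R * R + 3 * C) \<le> 1 / 2"
    using iterate_and_tolerance .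
  note cb = fwd.const_bounds
  define M where "M = real N * R ^ N"
  \<comment> \<open>Large enough for both uses: the norm of the right inverse (\<open>K1\<close>)
    and the factor of the defect in \<open>left_bound\<close> (\<open>K2\<close>).\<close>
  define K where "K = (2 * M + 1) * C * (1 + R)"
  have M: "0 < M" using N cb by (simp add: M_def)
  have K: "0 < K" unfolding K_def using M cb by (intro mult_pos_pos) auto
  have "(2 * M + 1) * C * 1 \<le> K"
    unfolding K_def using M cb by (intro mult_left_mono) auto
  then have K1: "(2 * (real N * R ^ N) + 1) * C \<le> K" by (simp add: M_def)
  have "M * ((1 + R) * C) \<le> (2 * M + 1) * ((1 + R) * C)"
    using M cb by (intro mult_right_mono) auto
  then have K2: "real N * R ^ N * (1 + R) * C \<le> K" by (simp add: M_def K_def algebra_simps)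
  define \<eta> where "\<eta> = 1 / (4 * K)"
  have \<eta>: "0 < \<eta>" using K by (simp add: \<eta>_def)
  obtain \<delta> where \<delta>: "\<delta> > 0" "\<And>x y. dist y x < \<delta> \<Longrightarrow> dist (fderiv f y) (fderiv f x) < \<eta> / 2"
    using fwd.uc_A \<eta> unfolding uniformly_continuous_on_def by (metis UNIV_I half_gt_zero)
  define \<rho> where "\<rho> = \<delta> / 2"
  have \<rho>: "0 < \<rho>" using \<delta> by (simp add: \<rho>_def)
  have near: "norm (fderiv f (y + z) - fderiv f y) \<le> \<eta> / 2" if "norm z \<le> \<rho>" for y z
    using \<delta>(2)[of "y + z" y] that \<delta>(1) by (simp add: dist_norm \<rho>_def)
  obtain d1 where d1: "0 < d1" and pert:
    "\<And>\<phi> \<phi>i. (\<And>x. \<phi> (\<phi>i x) = x) \<Longrightarrow> (\<And>x. \<phi>i (\<phi> x) = x) \<Longrightarrow> uc \<phi> \<Longrightarrow> uc \<phi>i \<Longrightarrow>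
       (\<And>x. norm (f x - \<phi> x) \<le> d1) \<Longrightarrow> perturbed \<phi> \<phi>i N e"
    using perturbed_if_close[OF e] by metis
  \<comment> \<open>\<open>d1\<close> makes \<open>g\<close> a perturbation in the linear sense;
    \<open>\<eta> / 2\<close> is the half of the tolerance \<open>\<eta>\<close> that
    \<open>near\<close> leaves for the difference of the derivatives;
    \<open>\<rho> / (8 * K)\<close> keeps sums of two displacements of size \<open>4 * K * d\<close>
    in the ball where \<open>lin\<close> holds.\<close>
  define d0 where "d0 = Min {d1, \<eta> / 2, \<rho> / (8 * K)}"
  have d0: "0 < d0" "d0 \<le> d1" "d0 \<le> \<eta> / 2" "d0 \<le> \<rho> / (8 * K)"
    using d1 \<eta> \<rho> K by (auto simp: d0_def)
  have lin: "norm (\<psi> (y + u) - \<psi> (y + v) - fderiv f y (u - v)) \<le> 1 / (4 * K) * norm (u - v)"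
    if "norm u \<le> \<rho>" "norm v \<le> \<rho>" and diff: "\<And>x. \<psi> differentiable (at x)"
      and close: "\<And>x. norm (fderiv f x - fderiv \<psi> x) \<le> d0" for \<psi> y u v
    unfolding \<eta>_def[symmetric]
  proof (rule blinfun_diff_bound[OF diff _ that(1,2)])
    fix z :: 'a assume z: "norm z \<le> \<rho>"
    have "fderiv \<psi> (y + z) - fderiv f y
        = (fderiv f (y + z) - fderiv f y) - (fderiv f (y + z) - fderiv \<psi> (y + z))" by simp
    also have "norm \<dots> \<le> \<eta> / 2 + \<eta> / 2"
      by (rule order_trans[OF norm_triangle_ineq4 add_mono])
        (intro near z order_trans[OF close d0(3)])+
    finally show "norm (fderiv \<psi> (y + z) - fderiv f y) \<le> \<eta>" by simp
  qed
  have f_diff: "f differentiable (at x)" for x using diffeo_classE[OF f] by metis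
  have lin_f: "norm (f (y + u) - f (y + v) - fderiv f y (u - v)) \<le> 1 / (4 * K) * norm (u - v)"
    if "norm u \<le> \<rho>" "norm v \<le> \<rho>" for y u v
    by (rule lin[OF that f_diff]) (use d0 in simp)
  have pert_f: "perturbed f (inv f) N e"
    by (rule pert) (use d1 in \<open>simp_all add: f_fi fi_f fwd.uc_f bwd.uc_f\<close>)
  have main: "\<exists>h1 h2. semiconj_pair f g (8 * K * d) h1 h2 \<and>
        ((\<forall>x y. stable_unstable_sum f P Q x = stable_unstable_sum f P Q y) \<longrightarrow>
          Id_plus h1 \<circ> Id_plus h2 = id \<and> Id_plus h2 \<circ> Id_plus h1 = id)"
    if d: "0 < d" "d < d0" and g: "g \<in> diffeo_class" and dist: "C1_dist f g < ereal d" for d g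
  proof -
    obtain Rg where bij: "bij g" and g_diff: "\<And>x. g differentiable (at x)" "\<And>x. inv g differentiable (at x)"
      and Rg: "\<And>x. norm (fderiv g x) \<le> Rg" "\<And>x. norm (fderiv (inv g) x) \<le> Rg"
      using diffeo_classE[OF g] by metis
    have inv_g: "g (inv g x) = x" "inv g (g x) = x" for x
      using bij by (simp_all add: bij_is_inj bij_is_surj surj_f_inv_f)
    have uc_g: "uc g" "uc (inv g)"
      by (rule uc_lipschitz, rule lipschitz_fderiv, rule g_diff, rule Rg)+
    note close = C1_dist_less[OF dist]
    have lin_g: "norm (g (y + u) - g (y + v) - fderiv f y (u - v)) \<le> 1 / (4 * K) * norm (u - v)"
      if "norm u \<le> \<rho>" "norm v \<le> \<rho>" for y u v
      by (rule lin[OF that g_diff(1)]) (use close(2) d(2) in \<open>force intro: order_trans\<close>)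
    have pert_g: "perturbed g (inv g) N e"
      using order_trans[OF close(1), of d1] d d0 by (intro pert inv_g uc_g) auto
    have close': "norm (g x - f x) \<le> d" for x using close(1)[of x] by (simp add: norm_minus_commute)
    have Kd: "8 * K * d \<le> \<rho>"
      using order_trans[OF less_imp_le[OF d(2)] d0(4)] K by (simp add: pos_le_divide_eq mult.commute)
    have Kd': "4 * K * d \<le> \<rho>" by (rule order_trans[OF _ Kd]) (use K d(1) in simp)
    obtain h1 where h1: "uc h1" "\<And>x. norm (h1 x) \<le> 4 * K * d" "\<And>x. g (x + h1 x) = f x + h1 (f x)"
      and h1F: "\<And>F x. subspace F \<Longrightarrow> (\<And>x. range (P x) \<subseteq> F) \<Longrightarrow>
          (\<And>x. fderiv f x -` range (Q (f x)) \<subseteq> F) \<Longrightarrow> h1 x \<in> F"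
      using semiconjugacy_exists[OF N size1 pert_f K K1 uc_g(1) lin_g close' Kd'] by metis
    obtain h2 where h2: "uc h2" "\<And>x. norm (h2 x) \<le> 4 * K * d" "\<And>x. f (x + h2 x) = g x + h2 (g x)"
      and h2F: "\<And>F x. subspace F \<Longrightarrow> (\<And>x. range (P x) \<subseteq> F) \<Longrightarrow>
          (\<And>x. fderiv f x -` range (Q (f x)) \<subseteq> F) \<Longrightarrow> h2 x \<in> F"
      using semiconjugacy_exists[OF N size1 pert_g K K1 fwd.uc_f lin_f close(1) Kd'] by metis
    \<comment> \<open>Doubling \<open>4 * K\<close> gives the strict bound demanded by
      \<open>semiconj_pair\<close>.\<close>
    have lt: "4 * K * d < 8 * K * d" using K d(1) by simp
    have "semiconj_pair f g (8 * K * d) h1 h2"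
      unfolding semiconj_pair_def
      using h1 h2 le_less_trans[OF h1(2) lt] le_less_trans[OF h2(2) lt] by (auto simp: fun_eq_iff)
    moreover have "Id_plus h1 \<circ> Id_plus h2 = id \<and> Id_plus h2 \<circ> Id_plus h1 = id"
      if const: "\<forall>x y. stable_unstable_sum f P Q x = stable_unstable_sum f P Q y"
    proof -
      define F where "F = stable_unstable_sum f P Q 0"
      have F: "F = stable_unstable_sum f P Q x" for x using const by (simp add: F_def)
      have sub: "subspace F" unfolding F_def by (rule subspace_stable_unstable_sum)
      have FP: "range (P x) \<subseteq> F" for x
      proof
        fix v assume "v \<in> range (P x)"
        moreover have "(0::'a) \<in> fderiv f x -` range (Q (f x))" by (auto intro: range_eqI[of _ _ 0])
        ultimately show "v \<in> F"
          unfolding F[of x] stable_unstable_sum_def using set_plus_intro[of v _ 0] by simp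
      qed
      have FQ: "fderiv f x -` range (Q (f x)) \<subseteq> F" for x
      proof
        fix v assume "v \<in> fderiv f x -` range (Q (f x))"
        moreover have "(0::'a) \<in> range (P x)" by (auto intro: range_eqI[of _ _ 0])
        ultimately show "v \<in> F"
          unfolding F[of x] stable_unstable_sum_def using set_plus_intro[of 0 _ v] by simp
      qed
      \<comment> \<open>Here the constancy of the sum is used: \<open>v\<close> is decomposed at the
        given \<open>x\<close>. The preimage summand lies in the range of \<open>Q x\<close> by
        \<open>Q_range_step\<close>, so it is exactly the unstable component of
        \<open>v\<close>.\<close>
      have FD: "fderiv f x (Q x v) \<in> range (Q (f x))" if vF: "v \<in> F" for x v
      proof -
        obtain p u where v: "v = p + u" and p: "p \<in> range (P x)" and u: "fderiv f x u \<in> range (Q (f x))"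
          using vF unfolding F[of x] stable_unstable_sum_def set_plus_def by blast
        have "Q x v = u"
          unfolding v blinfun.add_right Q_eq_0[OF p] Q_eq_self[OF Q_range_step[OF u]] by simp
        with u show ?thesis by simp
      qed
      \<comment> \<open>\<open>Id + k1\<close> is Id + h2 after Id + h1 and commutes with
        \<open>f\<close>; \<open>Id + k2\<close> is the composition in the other order and commutes
        with \<open>g\<close>.\<close>
      define k1 where "k1 x = h1 x + h2 (x + h1 x)" for x
      define k2 where "k2 x = h2 x + h1 (x + h2 x)" for x
      have kF: "k1 x \<in> F" "k2 x \<in> F" for x
        unfolding k1_def k2_def by (intro subspace_add[OF sub] h1F h2F sub FP FQ)+
      have kn: "norm (k1 x) \<le> 4 * K * d + 4 * K * d" "norm (k2 x) \<le> 4 * K * d + 4 * K * d" for x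
        unfolding k1_def k2_def by (intro norm_triangle_le add_mono h1 h2)+
      have k\<rho>: "norm (k1 x) \<le> \<rho>" "norm (k2 x) \<le> \<rho>" for x
        using Kd kn[of x] by linarith+
      have kQ: "fderiv f x (Q x (k1 x)) \<in> range (Q (f x))" "fderiv f x (Q x (k2 x)) \<in> range (Q (f x))" for x
        by (intro FD kF)+
      have comm1: "f (x + k1 x) = f x + k1 (f x)" for x
        using h2(3)[of "x + h1 x"] h1(3)[of x] by (simp add: k1_def add.assoc)
      have "k1 x = 0" for x
      proof (rule centralizer_trivial[where k = k1 and \<rho> = \<rho> and K = K])
        show "0 < N" by (fact N)
        show "2 * (C * C * lam ^ N) + e * (real N * R ^ N) * (R + R * R + 3 * C) \<le> 1 / 2" by (fact size2)
        show "perturbed f (inv f) N e" by (fact pert_f)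
      qed (fact K K2 lin_f k\<rho> kQ comm1)+
      moreover have comm2: "g (x + k2 x) = g x + k2 (g x)" for x
        using h1(3)[of "x + h2 x"] h2(3)[of x] by (simp add: k2_def add.assoc)
      moreover have "k2 x = 0" for x
      proof (rule centralizer_trivial[where k = k2 and \<rho> = \<rho> and K = K])
        show "0 < N" by (fact N)
        show "2 * (C * C * lam ^ N) + e * (real N * R ^ N) * (R + R * R + 3 * C) \<le> 1 / 2" by (fact size2)
        show "perturbed g (inv g) N e" by (fact pert_g)
      qed (fact K K2 lin_g k\<rho> kQ comm2)+
      ultimately show ?thesis
        by (simp add: fun_eq_iff k1_def k2_def add.assoc)
    qed
    ultimately show ?thesis by blast
  qed
  show ?thesis
    by (rule that[OF _ d0(1) main]) (use K in simp)
qed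

lemma homeomorphism_semiconj_pair:
  assumes "semiconj_pair f g c h1 h2" "Id_plus h1 \<circ> Id_plus h2 = id" "Id_plus h2 \<circ> Id_plus h1 = id"
  shows "homeomorphism UNIV UNIV (Id_plus h1) (Id_plus h2)" "homeomorphism UNIV UNIV (Id_plus h2) (Id_plus h1)"
    "uniformly_continuous_on UNIV (Id_plus h1)" "uniformly_continuous_on UNIV (Id_plus h2)"
    "inv (Id_plus h1) = Id_plus h2"
proof -
  show u: "uc (Id_plus h1)" "uc (Id_plus h2)"
    using assms(1) unfolding semiconj_pair_def
    by (auto intro!: uniformly_continuous_on_add uniformly_continuous_on_id)
  have c: "Id_plus h1 (Id_plus h2 x) = x" "Id_plus h2 (Id_plus h1 x) = x" for x
    using assms(2,3) by (auto simp: fun_eq_iff)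
  then show "homeomorphism UNIV UNIV (Id_plus h1) (Id_plus h2)"
    by (intro homeomorphismI uniformly_continuous_imp_continuous u) auto
  then show "homeomorphism UNIV UNIV (Id_plus h2) (Id_plus h1)" by (rule homeomorphism_symD)
  show "inv (Id_plus h1) = Id_plus h2" using assms(2,3) by (intro inv_unique_comp)
qed

theorem theorem16:
  fixes f :: "'a::banach \<Rightarrow> 'a"
    and P Q :: "'a \<Rightarrow> 'a \<Rightarrow>\<^sub>L 'a"
  assumes "f \<in> diffeo_class"
    and "uc_gen_hyperbolic f P Q"
  shows "(\<exists>M>0. \<exists>d0>0. \<forall>d. 0 < d \<and> d < d0 \<longrightarrow>
            (\<forall>g \<in> diffeo_class. C1_dist f g < ereal d \<longrightarrow>
               (\<exists>h1 h2. semiconj_pair f g (M * d) h1 h2) \<and>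
               ((\<forall>x y. stable_unstable_sum f P Q x = stable_unstable_sum f P Q y) \<longrightarrow>
                  (\<exists>h1 h2. semiconj_pair f g (M * d) h1 h2 \<and>
                     Id_plus h1 \<circ> Id_plus h2 = id \<and> Id_plus h2 \<circ> Id_plus h1 = id \<and>
                     homeomorphism UNIV UNIV (Id_plus h1) (Id_plus h2) \<and>
                     homeomorphism UNIV UNIV (Id_plus h2) (Id_plus h1))))) \<and>
         unif_semi_struct_stable f \<and>
         ((\<forall>x y. stable_unstable_sum f P Q x = stable_unstable_sum f P Q y) \<longrightarrow>
            unif_struct_stable f)"
proof -
  let ?const = "\<forall>x y. stable_unstable_sum f P Q x = stable_unstable_sum f P Q y"
  let ?inverse = "\<lambda>h1 h2. Id_plus h1 \<circ> Id_plus h2 = id \<and> Id_plus h2 \<circ> Id_plus h1 = id"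
  obtain M d0 where M: "0 < M" and d0: "0 < d0" and ex:
    "\<And>d g. 0 < d \<Longrightarrow> d < d0 \<Longrightarrow> g \<in> diffeo_class \<Longrightarrow> C1_dist f g < ereal d \<Longrightarrow>
      \<exists>h1 h2. semiconj_pair f g (M * d) h1 h2 \<and> (?const \<longrightarrow> ?inverse h1 h2)"
    by (rule semiconjugacies_exist[OF assms]) (rule that)
  have small: "\<exists>d1>0. \<forall>g\<in>diffeo_class. C1_dist f g < ereal d1 \<longrightarrow>
      (\<exists>h1 h2. semiconj_pair f g (M * d1) h1 h2 \<and> (?const \<longrightarrow> ?inverse h1 h2) \<and>
        sup_norm h1 < ereal \<epsilon> \<and> sup_norm h2 < ereal \<epsilon>)" if \<epsilon>: "0 < \<epsilon>" for \<epsilon>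
  proof (intro exI[of _ "min (d0 / 2) (\<epsilon> / (2 * M))"] conjI ballI impI)
    \<comment> \<open>Halving \<open>d0\<close> ensures \<open>?d < d0\<close>; the other bound
      gives \<open>M * ?d \<le> \<epsilon> / 2\<close>, so that even a supremum reaching the bound
      stays below \<open>\<epsilon>\<close>.\<close>
    let ?d = "min (d0 / 2) (\<epsilon> / (2 * M))"
    show d: "0 < ?d" using M d0 \<epsilon> by simp
    fix g assume g: "g \<in> diffeo_class" "C1_dist f g < ereal ?d"
    have "?d < d0" using d0 by auto
    from ex[OF d this g] obtain h1 h2 where h: "semiconj_pair f g (M * ?d) h1 h2" "?const \<longrightarrow> ?inverse h1 h2"
      by blast
    have "M * ?d \<le> M * (\<epsilon> / (2 * M))" using M by (intro mult_left_mono) auto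
    also have "\<dots> = \<epsilon> / 2" using M by simp
    finally have "norm (h1 x) \<le> \<epsilon> / 2 \<and> norm (h2 x) \<le> \<epsilon> / 2" for x
      using h(1) unfolding semiconj_pair_def by (meson less_imp_le order_trans)
    then have "sup_norm h1 \<le> ereal (\<epsilon> / 2)" "sup_norm h2 \<le> ereal (\<epsilon> / 2)"
      unfolding sup_norm_def by (auto intro!: SUP_least)
    moreover have "ereal (\<epsilon> / 2) < ereal \<epsilon>" using \<epsilon> by simp
    ultimately have "sup_norm h1 < ereal \<epsilon>" "sup_norm h2 < ereal \<epsilon>" using le_less_trans by blast+
    with h show "\<exists>h1 h2. semiconj_pair f g (M * ?d) h1 h2 \<and> (?const \<longrightarrow> ?inverse h1 h2) \<and>
        sup_norm h1 < ereal \<epsilon> \<and> sup_norm h2 < ereal \<epsilon>" by blast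
  qed
  show ?thesis
  proof (intro conjI impI)
    show "\<exists>M>0. \<exists>d0>0. \<forall>d. 0 < d \<and> d < d0 \<longrightarrow>
            (\<forall>g \<in> diffeo_class. C1_dist f g < ereal d \<longrightarrow>
               (\<exists>h1 h2. semiconj_pair f g (M * d) h1 h2) \<and>
               (?const \<longrightarrow> (\<exists>h1 h2. semiconj_pair f g (M * d) h1 h2 \<and>
                     Id_plus h1 \<circ> Id_plus h2 = id \<and> Id_plus h2 \<circ> Id_plus h1 = id \<and>
                     homeomorphism UNIV UNIV (Id_plus h1) (Id_plus h2) \<and>
                     homeomorphism UNIV UNIV (Id_plus h2) (Id_plus h1))))"
    proof (rule exI[of _ M], intro conjI M, rule exI[of _ d0], intro conjI d0 allI ballI impI; elim conjE)
      fix d g assume "0 < d" "d < d0" "g \<in> diffeo_class" "C1_dist f g < ereal d"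
      from ex[OF this] obtain h1 h2
        where h: "semiconj_pair f g (M * d) h1 h2" "?const \<longrightarrow> ?inverse h1 h2" by blast
      then show "\<exists>h1 h2. semiconj_pair f g (M * d) h1 h2" by blast
      assume ?const
      with h(2) have inverse: "Id_plus h1 \<circ> Id_plus h2 = id" "Id_plus h2 \<circ> Id_plus h1 = id" by blast+
      show "\<exists>h1 h2. semiconj_pair f g (M * d) h1 h2 \<and>
          Id_plus h1 \<circ> Id_plus h2 = id \<and> Id_plus h2 \<circ> Id_plus h1 = id \<and>
          homeomorphism UNIV UNIV (Id_plus h1) (Id_plus h2) \<and>
          homeomorphism UNIV UNIV (Id_plus h2) (Id_plus h1)"
        using h(1) inverse homeomorphism_semiconj_pair(1,2)[OF h(1) inverse] by blast
    qed
    show "unif_semi_struct_stable f"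
      unfolding unif_semi_struct_stable_def
    proof (intro allI impI)
      fix \<epsilon> :: real assume "0 < \<epsilon>"
      from small[OF this] show "\<exists>d0>0. \<forall>g \<in> diffeo_class. C1_dist f g < ereal d0 \<longrightarrow>
        (\<exists>h1 h2. uniformly_continuous_on UNIV h1 \<and> uniformly_continuous_on UNIV h2 \<and>
           sup_norm h1 < ereal \<epsilon> \<and> sup_norm h2 < ereal \<epsilon> \<and>
           g \<circ> Id_plus h1 = Id_plus h1 \<circ> f \<and> f \<circ> Id_plus h2 = Id_plus h2 \<circ> g)"
        unfolding semiconj_pair_def by meson
    qed
    show "unif_struct_stable f" if const: ?const
      unfolding unif_struct_stable_def
    proof (intro allI impI)
      fix \<epsilon> :: real assume "0 < \<epsilon>"
      from small[OF this] obtain d1 where d1: "0 < d1" and ex1: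
        "\<And>g. g \<in> diffeo_class \<Longrightarrow> C1_dist f g < ereal d1 \<Longrightarrow>
          \<exists>h1 h2. semiconj_pair f g (M * d1) h1 h2 \<and> (?const \<longrightarrow> ?inverse h1 h2) \<and>
            sup_norm h1 < ereal \<epsilon> \<and> sup_norm h2 < ereal \<epsilon>" by blast
      show "\<exists>d0>0. \<forall>g \<in> diffeo_class. C1_dist f g < ereal d0 \<longrightarrow>
        (\<exists>h1. continuous_on UNIV h1 \<and> sup_norm h1 < ereal \<epsilon> \<and>
           homeomorphism UNIV UNIV (Id_plus h1) (inv (Id_plus h1)) \<and>
           g \<circ> Id_plus h1 = Id_plus h1 \<circ> f \<and>
           uniformly_continuous_on UNIV (Id_plus h1) \<and>
           uniformly_continuous_on UNIV (inv (Id_plus h1)))"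
      proof (intro exI[of _ d1] conjI d1 ballI impI)
        fix g assume "g \<in> diffeo_class" "C1_dist f g < ereal d1"
        from ex1[OF this] const obtain h1 h2 where h: "semiconj_pair f g (M * d1) h1 h2"
          and inverse: "Id_plus h1 \<circ> Id_plus h2 = id" "Id_plus h2 \<circ> Id_plus h1 = id"
          and sn: "sup_norm h1 < ereal \<epsilon>" by blast
        note hom = homeomorphism_semiconj_pair[OF h inverse]
        show "\<exists>h1. continuous_on UNIV h1 \<and> sup_norm h1 < ereal \<epsilon> \<and>
           homeomorphism UNIV UNIV (Id_plus h1) (inv (Id_plus h1)) \<and>
           g \<circ> Id_plus h1 = Id_plus h1 \<circ> f \<and>
           uniformly_continuous_on UNIV (Id_plus h1) \<and>
           uniformly_continuous_on UNIV (inv (Id_plus h1))"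
          using h sn hom unfolding semiconj_pair_def
          by (intro exI[of _ h1]) (simp add: hom(5) uniformly_continuous_imp_continuous)
      qed
    qed
  qed
qed

end
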